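(* Let $m\ge1$ and $r\ge2$ be integers, $B\subset\mathbb C^m$ the open Euclidean unit ball, $V$ a complex vector space of dimension $r$, and $F=B\times V\to B$ the trivial vector bundle. Given positively curved metrics $\mathsf k_1,\mathsf k_2,\mathsf k_3$ on $O_{\mathbb P V}(1)$ such that $\mathsf k_1>\mathsf k_2>\mathsf k_3$ away from the zero section, there are positive numbers $r_1<r_2<r_3<1$ and a positively curved metric $k$ on $O_{\mathbb P F}(1)$ such that for any $j=1,2,3$ \[ k|O_{\mathbb P F_s}(1)=\mathsf k_j\qquad\text{if } s\in B,\ \|s\|=r_j. \] Moreover, if $\|s\|$ is sufficiently close to $r_j$, then $k|O_{\mathbb P F_s}(1)=c_s\mathsf k_j$ with a constant $c_s>0$ (depending on $s$).
   Context: **Metrics and curvature.** A hermitian metric on a finite dimensional complex vector space is a function of the form $v\mapsto\hat h(v,v)$, with $\hat h$ a positive definite hermitian form. A (hermitian) metric on a holomorphic vector bundle $E\to S$ is a function $h:E\to\mathbb R$ on the total space whose restriction to each fiber is a hermitian metric in this sense; it is smooth if $h$ is $C^\infty$. The metric $h$ is negatively curved if $h$ is smooth and strongly plurisubharmonic ($i\partial\bar\partial h>0$) on the total space away from the zero section. The metric $h$ is positively curved if the dual metric $h^*$ on the dual bundle $E^*$ is negatively curved. **The bundle $O_{\mathbb P E}(1)$.** For a holomorphic vector bundle $E\to S$, $\mathbb P E=\coprod_{s\in S}\mathbb P E_s$ is the set of hyperplanes (linear subspaces of codimension one) $P\subset E_s$ in the fibers of $E$, with its natural complex manifold structure and projection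 $\pi:\mathbb P E\to S$. Then $O_{\mathbb P E}(1)\to \mathbb P E$ is the holomorphic line bundle $(\pi^*E)/H$, where $H\subset\pi^*E$ is the tautological subbundle whose fiber over $P\in\mathbb P E_s$ is $P$; so its fiber over $P\in\mathbb P E_s$ is $E_s/P$. For a vector space $V$ (the case when $S$ is a point) this gives $O_{\mathbb P V}(1)\to\mathbb P V$. **Identification.** $F_s=\{s\}\times V$ is identified with $V$, and so $O_{\mathbb P F_s}(1)$ with $O_{\mathbb P V}(1)$. $\|\ \|$ is the Euclidean norm on $\mathbb C^m$. *)

theory Defs
  imports "HOL-Analysis.Analysis"
begin

section \<open>Smooth and strongly plurisubharmonic functions on open subsets of complex n-space\<close>

text \<open>Differentiability is real (Frechet) differentiability; the sets are meant to be open.\<close>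

fun Ck_on :: "nat \<Rightarrow> 'a::real_normed_vector set \<Rightarrow> ('a \<Rightarrow> 'b::real_normed_vector) \<Rightarrow> bool" where
  "Ck_on 0 S f \<longleftrightarrow> continuous_on S f"
| "Ck_on (Suc n) S f \<longleftrightarrow>
     (\<forall>x\<in>S. f differentiable (at x)) \<and>
     (\<forall>v. Ck_on n S (\<lambda>x. frechet_derivative f (at x) v))"

definition smooth_on :: "'a::real_normed_vector set \<Rightarrow> ('a \<Rightarrow> 'b::real_normed_vector) \<Rightarrow> bool" where
  "smooth_on S f \<longleftrightarrow> (\<forall>n. Ck_on n S f)"

definition d_z :: "'n::finite \<Rightarrow> (complex ^ 'n \<Rightarrow> complex) \<Rightarrow> complex ^ 'n \<Rightarrow> complex" where
  "d_z j f z = (frechet_derivative f (at z) (axis j 1)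
                - \<i> * frechet_derivative f (at z) (axis j \<i>)) / 2"

definition d_zbar :: "'n::finite \<Rightarrow> (complex ^ 'n \<Rightarrow> complex) \<Rightarrow> complex ^ 'n \<Rightarrow> complex" where
  "d_zbar j f z = (frechet_derivative f (at z) (axis j 1)
                   + \<i> * frechet_derivative f (at z) (axis j \<i>)) / 2"

text \<open>
  Positivity of the (1,1)-form i ddbar u, i.e. positive definiteness of the complex Hessian.
  For smooth real u the Hessian is hermitian, so the double sum is real.
\<close>

definition strongly_psh_on :: "(complex ^ 'n::finite) set \<Rightarrow> (complex ^ 'n \<Rightarrow> real) \<Rightarrow> bool" where
  "strongly_psh_on S u \<longleftrightarrow> smooth_on S u \<and>
     (\<forall>z\<in>S. \<forall>w. w \<noteq> 0 \<longrightarrow>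
        0 < Re (\<Sum>j\<in>UNIV. \<Sum>k\<in>UNIV.
                  d_z j (d_zbar k (\<lambda>x. complex_of_real (u x))) z * (w $ j) * cnj (w $ k)))"


section \<open>Complex vector spaces with explicit operations\<close>

text \<open>The fibers of the bundles below, such as E/P, are not types.\<close>

record 'e cvs =
  vcarrier :: "'e set"
  vadd :: "'e \<Rightarrow> 'e \<Rightarrow> 'e"
  vzero :: "'e"
  vsmul :: "complex \<Rightarrow> 'e \<Rightarrow> 'e"

definition cvs_of :: "(complex \<Rightarrow> 'v::ab_group_add \<Rightarrow> 'v) \<Rightarrow> 'v cvs" where
  "cvs_of smul = \<lparr>vcarrier = UNIV, vadd = (+), vzero = 0, vsmul = smul\<rparr>"

definition linear_iso :: "'e cvs \<Rightarrow> ('e \<Rightarrow> complex ^ 'f::finite) \<Rightarrow> bool" where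
  "linear_iso W T \<longleftrightarrow> bij_betw T (vcarrier W) UNIV \<and>
     (\<forall>u\<in>vcarrier W. \<forall>v\<in>vcarrier W. T (vadd W u v) = T u + T v) \<and>
     (\<forall>c. \<forall>v\<in>vcarrier W. T (vsmul W c v) = c *s T v)"

definition std_frame :: "'e cvs \<Rightarrow> ('e \<Rightarrow> complex ^ 'f::finite) \<Rightarrow> 'f \<Rightarrow> 'e" where
  "std_frame W T a = inv_into (vcarrier W) T (axis a 1)"

definition is_subspace :: "'e set \<Rightarrow> 'e cvs \<Rightarrow> bool" where
  "is_subspace P W \<longleftrightarrow> P \<subseteq> vcarrier W \<and> vzero W \<in> P \<and>
     (\<forall>u\<in>P. \<forall>v\<in>P. vadd W u v \<in> P) \<and> (\<forall>c. \<forall>v\<in>P. vsmul W c v \<in> P)"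

definition coset :: "'e cvs \<Rightarrow> 'e set \<Rightarrow> 'e \<Rightarrow> 'e set" where
  "coset W P v = {vadd W v p | p. p \<in> P}"

definition quotient_space :: "'e cvs \<Rightarrow> 'e set \<Rightarrow> 'e set cvs" where
  "quotient_space W P =
     \<lparr>vcarrier = coset W P ` vcarrier W,
      vadd = (\<lambda>A B. {vadd W a b | a b. a \<in> A \<and> b \<in> B}),
      vzero = P,
      vsmul = (\<lambda>c A. {vadd W (vsmul W c a) p | a p. a \<in> A \<and> p \<in> P})\<rparr>"

definition one_dimensional :: "'e cvs \<Rightarrow> bool" where
  "one_dimensional W \<longleftrightarrow>
     (\<exists>u\<in>vcarrier W. u \<noteq> vzero W \<and> (\<forall>v\<in>vcarrier W. \<exists>c. v = vsmul W c u))"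

definition hyperplanes :: "'e cvs \<Rightarrow> 'e set set" where
  "hyperplanes W = {P. is_subspace P W \<and> one_dimensional (quotient_space W P)}"

definition dual_space :: "'e cvs \<Rightarrow> ('e \<Rightarrow> complex) cvs" where
  "dual_space W =
     \<lparr>vcarrier = {\<xi> \<in> extensional (vcarrier W).
        (\<forall>u\<in>vcarrier W. \<forall>v\<in>vcarrier W. \<xi> (vadd W u v) = \<xi> u + \<xi> v) \<and>
        (\<forall>c. \<forall>v\<in>vcarrier W. \<xi> (vsmul W c v) = c * \<xi> v)},
      vadd = (\<lambda>\<xi> \<eta>. \<lambda>v\<in>vcarrier W. \<xi> v + \<eta> v),
      vzero = (\<lambda>v\<in>vcarrier W. 0),
      vsmul = (\<lambda>c \<xi>. \<lambda>v\<in>vcarrier W. c * \<xi> v)\<rparr>"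

definition pos_def_hermitian_form :: "'e cvs \<Rightarrow> ('e \<Rightarrow> 'e \<Rightarrow> complex) \<Rightarrow> bool" where
  "pos_def_hermitian_form W g \<longleftrightarrow>
     (\<forall>u\<in>vcarrier W. \<forall>v\<in>vcarrier W. \<forall>w\<in>vcarrier W. g (vadd W u v) w = g u w + g v w) \<and>
     (\<forall>c. \<forall>u\<in>vcarrier W. \<forall>w\<in>vcarrier W. g (vsmul W c u) w = c * g u w) \<and>
     (\<forall>u\<in>vcarrier W. \<forall>w\<in>vcarrier W. g w u = cnj (g u w)) \<and>
     (\<forall>u\<in>vcarrier W. u \<noteq> vzero W \<longrightarrow> 0 < Re (g u u))"

definition hermitian_metric :: "'e cvs \<Rightarrow> ('e \<Rightarrow> real) \<Rightarrow> bool" where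
  "hermitian_metric W q \<longleftrightarrow>
     (\<exists>g. pos_def_hermitian_form W g \<and> (\<forall>v\<in>vcarrier W. complex_of_real (q v) = g v v))"


section \<open>Holomorphic vector bundles, metrics, curvature\<close>

text \<open>
  A bundle is a family of complex vector spaces over a base set, with an atlas of triples
  (U, phi, tau): phi is a holomorphic coordinate system on the open set U of the base, and
  tau x is a linear isomorphism from the fiber over x in U onto complex f-space, forming a
  holomorphic local trivialization. The total space consists of the pairs (x, v) with v in the
  fiber over x; the maps (x, v) to (phi x, tau x v) are its complex coordinates.
\<close>

record ('x, 'e, 'b::finite, 'f::finite) vbundle =
  base :: "'x set"
  fiber :: "'x \<Rightarrow> 'e cvs"
  atlas :: "('x set \<times> ('x \<Rightarrow> complex ^ 'b) \<times> ('x \<Rightarrow> 'e \<Rightarrow> complex ^ 'f)) set"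

definition total_dom :: "('x, 'e, 'b::finite, 'f::finite) vbundle \<Rightarrow> 'x set \<Rightarrow> ('x \<times> 'e) set" where
  "total_dom E U = (SIGMA x:U. vcarrier (fiber E x))"

definition zero_section :: "('x, 'e, 'b::finite, 'f::finite) vbundle \<Rightarrow> ('x \<times> 'e) set" where
  "zero_section E = {(x, vzero (fiber E x)) | x. x \<in> base E}"

definition total_coord ::
  "('x \<Rightarrow> complex ^ 'b::finite) \<Rightarrow> ('x \<Rightarrow> 'e \<Rightarrow> complex ^ 'f::finite)
   \<Rightarrow> 'x \<times> 'e \<Rightarrow> complex ^ ('b + 'f)" where
  "total_coord \<phi> \<tau> = (\<lambda>(x, v). \<chi> i. case i of Inl b \<Rightarrow> \<phi> x $ b | Inr a \<Rightarrow> \<tau> x v $ a)"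

definition bundle_metric :: "('x, 'e, 'b::finite, 'f::finite) vbundle \<Rightarrow> ('x \<times> 'e \<Rightarrow> real) \<Rightarrow> bool" where
  "bundle_metric E h \<longleftrightarrow> (\<forall>x\<in>base E. hermitian_metric (fiber E x) (\<lambda>v. h (x, v)))"

definition smooth_on_total :: "('x, 'e, 'b::finite, 'f::finite) vbundle \<Rightarrow> ('x \<times> 'e \<Rightarrow> real) \<Rightarrow> bool" where
  "smooth_on_total E h \<longleftrightarrow> (\<forall>(U, \<phi>, \<tau>)\<in>atlas E.
     smooth_on (total_coord \<phi> \<tau> ` total_dom E U)
       (h \<circ> inv_into (total_dom E U) (total_coord \<phi> \<tau>)))"

definition strongly_psh_off_zero :: "('x, 'e, 'b::finite, 'f::finite) vbundle \<Rightarrow> ('x \<times> 'e \<Rightarrow> real) \<Rightarrow> bool" where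
  "strongly_psh_off_zero E h \<longleftrightarrow> (\<forall>(U, \<phi>, \<tau>)\<in>atlas E.
     strongly_psh_on (total_coord \<phi> \<tau> ` (total_dom E U - zero_section E))
       (h \<circ> inv_into (total_dom E U) (total_coord \<phi> \<tau>)))"

definition negatively_curved :: "('x, 'e, 'b::finite, 'f::finite) vbundle \<Rightarrow> ('x \<times> 'e \<Rightarrow> real) \<Rightarrow> bool" where
  "negatively_curved E h \<longleftrightarrow>
     bundle_metric E h \<and> smooth_on_total E h \<and> strongly_psh_off_zero E h"

text \<open>A local trivialization of E with frame e induces xi to (xi (e a)) for a in 'f on the dual.\<close>

definition dual_bundle ::
  "('x, 'e, 'b::finite, 'f::finite) vbundle \<Rightarrow> ('x, 'e \<Rightarrow> complex, 'b, 'f) vbundle" where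
  "dual_bundle E =
     \<lparr>base = base E,
      fiber = (\<lambda>x. dual_space (fiber E x)),
      atlas = (\<lambda>(U, \<phi>, \<tau>). (U, \<phi>, \<lambda>x \<xi>. \<chi> a. \<xi> (std_frame (fiber E x) (\<tau> x) a))) ` atlas E\<rparr>"

text \<open>Metrics are squared norms, hence so is the dual metric.\<close>

definition dual_metric ::
  "('x, 'e, 'b::finite, 'f::finite) vbundle \<Rightarrow> ('x \<times> 'e \<Rightarrow> real) \<Rightarrow> 'x \<times> ('e \<Rightarrow> complex) \<Rightarrow> real" where
  "dual_metric E h = (\<lambda>(x, \<xi>).
     SUP v\<in>vcarrier (fiber E x) - {vzero (fiber E x)}. (cmod (\<xi> v))\<^sup>2 / h (x, v))"

definition positively_curved :: "('x, 'e, 'b::finite, 'f::finite) vbundle \<Rightarrow> ('x \<times> 'e \<Rightarrow> real) \<Rightarrow> bool" where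
  "positively_curved E h \<longleftrightarrow>
     bundle_metric E h \<and> negatively_curved (dual_bundle E) (dual_metric E h)"


section \<open>Projectivization and the bundle O(1)\<close>

text \<open>
  Let e be a basis of W indexed by 'd option, so that dim W = CARD('d) + 1. A hyperplane P not
  containing e None is the kernel of a unique functional l with l (e None) = 1; its affine
  coordinates are the numbers l (e (Some j)), and W/P is trivialized by the class of e None,
  that is, by v + P to l v. Both are expressed through l v = z iff v is in z e None + P.
\<close>

definition affine_coord :: "'e cvs \<Rightarrow> ('d option \<Rightarrow> 'e) \<Rightarrow> 'e set \<Rightarrow> complex ^ 'd::finite" where
  "affine_coord W e P = (\<chi> j. THE z. e (Some j) \<in> coset W P (vsmul W z (e None)))"

definition quotient_triv :: "'e cvs \<Rightarrow> ('d option \<Rightarrow> 'e) \<Rightarrow> 'e set \<Rightarrow> complex ^ 1" where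
  "quotient_triv W e A = (\<chi> _. THE z. vsmul W z (e None) \<in> A)"

definition O1_space :: "'e cvs \<Rightarrow> ('e set, 'e set, 'd::finite, 1) vbundle" where
  "O1_space W =
     \<lparr>base = hyperplanes W,
      fiber = quotient_space W,
      atlas = {({P \<in> hyperplanes W. e None \<notin> P}, affine_coord W e, \<lambda>P. quotient_triv W e)
                | e. \<exists>T :: 'e \<Rightarrow> complex ^ ('d option). linear_iso W T \<and> e = std_frame W T}\<rparr>"

text \<open>
  The same over each point of the base of E; a point of PE is a pair (s, P) with P a hyperplane in
  the fiber over s. The permutation p lets every member of a frame play the role of e None.
\<close>

definition O1_bundle ::
  "('x, 'e, 'b::finite, 'd::finite option) vbundle \<Rightarrow> ('x \<times> 'e set, 'e set, 'b + 'd, 1) vbundle" where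
  "O1_bundle E =
     \<lparr>base = (SIGMA s:base E. hyperplanes (fiber E s)),
      fiber = (\<lambda>(s, P). quotient_space (fiber E s) P),
      atlas = {({(s, P). s \<in> U \<and> P \<in> hyperplanes (fiber E s) \<and> e s None \<notin> P},
                (\<lambda>(s, P). \<chi> i. case i of Inl b \<Rightarrow> \<phi> s $ b
                                       | Inr j \<Rightarrow> affine_coord (fiber E s) (e s) P $ j),
                (\<lambda>(s, P). quotient_triv (fiber E s) (e s)))
                | U \<phi> e. \<exists>\<tau> p. (U, \<phi>, \<tau>) \<in> atlas E \<and> bij p \<and>
                    e = (\<lambda>s a. std_frame (fiber E s) (\<tau> s) (p a))}\<rparr>"

definition trivial_bundle ::
  "(complex ^ 'm) set \<Rightarrow> 'e cvs \<Rightarrow> (complex ^ 'm, 'e, 'm::finite, 'f::finite) vbundle" where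
  "trivial_bundle B W =
     \<lparr>base = B, fiber = (\<lambda>s. W), atlas = {(B, (\<lambda>s. s), (\<lambda>s. T)) | T. linear_iso W T}\<rparr>"

end

theory Submission
  imports Defs "HOL-Computational_Algebra.Polynomial"
begin

text \<open>
  In an affine chart of the projective space with fiber coordinate t, the dual of a metric on O(1)
  has the form |t|^2 exp(phi), and it is strongly plurisubharmonic off t = 0 exactly when the weight
  phi is strongly plurisubharmonic. So we need a weight on the product of the ball with the
  projective space that agrees with phi_j + const near the sphere of radius r_j. A regularized
  maximum of the three weights phi_j + m_j (|s|^2 - r_j^2) does this: since the differences
  phi_2 - phi_1 and phi_3 - phi_2 lie in a compact subset of the positive half-line, the slopes
  m_1 < m_2 < m_3 and the radii can be chosen such that the j-th weight dominates near |s| = r_j.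
\<close>

section \<open>Calculus of smooth functions\<close>

text \<open>With \<phi>_j = - ln \<kappa>_j the order of the metrics reverses: \<phi>_1 < \<phi>_2 <
  \<phi>_3. Two opposite demands fix the constants. On an inner sphere the smaller weight must win,
  so the radial term of a larger one must have dropped there by more than the upper bound of the
  difference. On an outer sphere the larger weight must win, so the radial term of a smaller one may
  have risen by no more than the lower bound. The weights live only in charts, while their
  differences are functions on the projective space. As the regularized maximum commutes with adding
  one number to all its arguments, the metric can be written globally: \<kappa>_1 times exp of minus
  the regularized maximum of 0, \<phi>_2 - \<phi>_1 and \<phi>_3 - \<phi>_1, each with its radial
  term. A plain maximum would have corners; the smoothing acts only where two arguments differ by
  less than \<epsilon>, so a domination margin leaves one weight exactly.\<close>

lemma Ck_on_cong:
  assumes "open S" "\<And>x. x \<in> S \<Longrightarrow> f x = g x" "Ck_on n S f"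
  shows "Ck_on n S g"
  using assms(2,3)
proof (induction n arbitrary: f g)
  case 0
  then show ?case using continuous_on_eq[of S f g] by simp
next
  case (Suc n)
  have D: "(g has_derivative frechet_derivative f (at x)) (at x)" if "x \<in> S" for x
  proof (rule has_derivative_transform_within_open[OF _ assms(1) that])
    show "(f has_derivative frechet_derivative f (at x)) (at x)"
      using Suc.prems(2) that by (simp add: frechet_derivative_works)
  qed (rule Suc.prems(1))
  have "Ck_on n S (\<lambda>x. frechet_derivative g (at x) v)" for v
  proof (rule Suc.IH)
    show "Ck_on n S (\<lambda>x. frechet_derivative f (at x) v)" using Suc.prems by simp
    show "frechet_derivative f (at x) v = frechet_derivative g (at x) v" if "x \<in> S" for x
      using frechet_derivative_at[OF D[OF that]] by simp
  qed
  then show ?case using D by (auto simp: differentiable_def)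
qed

text \<open>\<open>Ck_on\<close> is phrased with \<open>frechet_derivative\<close>, a choice
  operator. This rule accepts any explicit derivative \<open>f'\<close>, and most of the inductions
  below go through it.\<close>

lemma Ck_on_SucI:
  assumes "open S" "\<And>x. x \<in> S \<Longrightarrow> (f has_derivative f' x) (at x)"
    and "\<And>v. Ck_on n S (\<lambda>x. f' x v)"
  shows "Ck_on (Suc n) S f"
proof -
  have "Ck_on n S (\<lambda>x. frechet_derivative f (at x) v)" for v
    by (rule Ck_on_cong[OF assms(1) _ assms(3)[of v]])
      (simp add: frechet_derivative_at[OF assms(2), symmetric])
  then show ?thesis using assms(2) by (auto simp: differentiable_def)
qed

lemma Ck_on_SucD:
  assumes "Ck_on (Suc n) S f" "x \<in> S"
  shows "(f has_derivative frechet_derivative f (at x)) (at x)"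
  using assms by (simp add: frechet_derivative_works)

lemma Ck_on_Suc_imp: "Ck_on (Suc n) S f \<Longrightarrow> Ck_on n S f"
proof (induction n arbitrary: f)
  case 0
  then show ?case
    by (auto intro!: continuous_at_imp_continuous_on differentiable_imp_continuous_within)
next
  case (Suc n)
  show ?case
    unfolding Ck_on.simps(2)[of n]
  proof (intro conjI allI)
    show "\<forall>x\<in>S. f differentiable (at x)" using Suc.prems by simp
    show "Ck_on n S (\<lambda>x. frechet_derivative f (at x) v)" for v
      by (rule Suc.IH) (use Suc.prems in simp)
  qed
qed

lemma Ck_on_subset: "Ck_on n S f \<Longrightarrow> S' \<subseteq> S \<Longrightarrow> Ck_on n S' f"
  by (induction n arbitrary: f) (auto intro: continuous_on_subset)

lemma Ck_on_const: "open S \<Longrightarrow> Ck_on n S (\<lambda>x. c)"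
proof (induction n arbitrary: c)
  case (Suc n)
  show ?case by (rule Ck_on_SucI[where f' = "\<lambda>_ _. 0"]) (use Suc in auto)
qed simp

lemma Ck_on_add:
  assumes "open S" "Ck_on n S f" "Ck_on n S g"
  shows "Ck_on n S (\<lambda>x. f x + g x)"
  using assms(2,3)
proof (induction n arbitrary: f g)
  case (Suc n)
  show ?case
  proof (rule Ck_on_SucI[OF assms(1)])
    show "((\<lambda>x. f x + g x) has_derivative
        (\<lambda>v. frechet_derivative f (at x) v + frechet_derivative g (at x) v)) (at x)" if "x \<in> S" for x
      using Suc.prems that by (intro derivative_intros Ck_on_SucD)
    show "Ck_on n S (\<lambda>x. frechet_derivative f (at x) v + frechet_derivative g (at x) v)" for v
      by (rule Suc.IH) (use Suc.prems in auto)
  qed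
qed (simp add: continuous_on_add continuous_on_mult)

lemma Ck_on_mult:
  fixes f g :: "'a::real_normed_vector \<Rightarrow> real"
  assumes "open S" "Ck_on n S f" "Ck_on n S g"
  shows "Ck_on n S (\<lambda>x. f x * g x)"
  using assms(2,3)
proof (induction n arbitrary: f g)
  case (Suc n)
  show ?case
  proof (rule Ck_on_SucI[OF assms(1)])
    show "((\<lambda>x. f x * g x) has_derivative
        (\<lambda>v. f x * frechet_derivative g (at x) v + frechet_derivative f (at x) v * g x)) (at x)"
      if "x \<in> S" for x
      using Suc.prems that by (intro derivative_intros Ck_on_SucD)
    \<comment> \<open>In each product one factor is differentiated and so of class \<open>n\<close>;
      the other is \<open>f\<close> or \<open>g\<close> itself, lowered from \<open>Suc n\<close> to
      \<open>n\<close>.\<close>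
    show "Ck_on n S (\<lambda>x. f x * frechet_derivative g (at x) v + frechet_derivative f (at x) v * g x)" for v
      by (intro Ck_on_add Suc.IH assms(1)) (use Suc.prems Suc.prems[THEN Ck_on_Suc_imp] in auto)
  qed
qed (simp add: continuous_on_add continuous_on_mult)

text \<open>Because the outer function has a real argument, its derivative is multiplication by the
  number \<open>frechet_derivative g (at (f x)) 1\<close>. The chain rule then yields a product of
  two functions, which \<open>Ck_on_mult\<close> handles. Together with precomposition by affine
  maps this covers the compositions that occur later.\<close>

lemma Ck_on_compose_real:
  fixes f :: "'a::real_normed_vector \<Rightarrow> real" and g :: "real \<Rightarrow> real"
  assumes "open S" "open T" "Ck_on n T g" "Ck_on n S f" "f ` S \<subseteq> T"
  shows "Ck_on n S (\<lambda>x. g (f x))"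
  using assms(3,4)
proof (induction n arbitrary: g)
  case 0
  then show ?case using assms(5) by (auto intro: continuous_on_compose2)
next
  case (Suc n)
  show ?case
  proof (rule Ck_on_SucI[OF assms(1)])
    fix x assume x: "x \<in> S"
    have g: "(g has_derivative frechet_derivative g (at (f x))) (at (f x))"
      using Suc.prems x assms(5) by (intro Ck_on_SucD[of n T]) auto
    have "((\<lambda>x. g (f x)) has_derivative
        (\<lambda>v. frechet_derivative g (at (f x)) (frechet_derivative f (at x) v))) (at x)"
      using diff_chain_at[OF Ck_on_SucD[OF Suc.prems(2) x] g] by (simp add: o_def)
    also have "(\<lambda>v. frechet_derivative g (at (f x)) (frechet_derivative f (at x) v)) =
       (\<lambda>v. frechet_derivative g (at (f x)) 1 * frechet_derivative f (at x) v)"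
    proof
      fix v
      show "frechet_derivative g (at (f x)) (frechet_derivative f (at x) v) =
         frechet_derivative g (at (f x)) 1 * frechet_derivative f (at x) v"
        using linear_cmul[OF has_derivative_linear[OF g], of "frechet_derivative f (at x) v" 1] by simp
    qed
    finally show "((\<lambda>x. g (f x)) has_derivative
        (\<lambda>v. frechet_derivative g (at (f x)) 1 * frechet_derivative f (at x) v)) (at x)" .
  next
    show "Ck_on n S (\<lambda>x. frechet_derivative g (at (f x)) 1 * frechet_derivative f (at x) v)" for v
      using Suc.prems Suc.prems(2)[THEN Ck_on_Suc_imp]
      by (intro Ck_on_mult assms(1) Suc.IH[of "\<lambda>y. frechet_derivative g (at y) 1"]) auto
  qed
qed

lemma Ck_on_compose_affine:
  fixes f :: "'b::real_normed_vector \<Rightarrow> 'c::real_normed_vector" and L :: "'a::real_normed_vector \<Rightarrow> 'b"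
  assumes "open S" "Ck_on n T f" "bounded_linear L" "\<And>x. x \<in> S \<Longrightarrow> c + L x \<in> T"
  shows "Ck_on n S (\<lambda>x. f (c + L x))"
  using assms(2)
proof (induction n arbitrary: f)
  case 0
  have "continuous_on S (\<lambda>x. c + L x)"
    using assms(3) by (intro continuous_intros linear_continuous_on)
  then show ?case using assms(4) 0 by (auto intro: continuous_on_compose2)
next
  case (Suc n)
  show ?case
  proof (rule Ck_on_SucI[OF assms(1)])
    fix x assume x: "x \<in> S"
    have L: "((\<lambda>x. c + L x) has_derivative L) (at x)"
      using has_derivative_add[OF has_derivative_const bounded_linear_imp_has_derivative[OF assms(3)]]
      by simp
    show "((\<lambda>x. f (c + L x)) has_derivative (\<lambda>v. frechet_derivative f (at (c + L x)) (L v))) (at x)"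
      using diff_chain_at[OF L Ck_on_SucD[OF Suc.prems assms(4)[OF x]]] by (simp add: o_def)
  next
    show "Ck_on n S (\<lambda>x. frechet_derivative f (at (c + L x)) (L v))" for v
      using Suc.prems by (intro Suc.IH[of "\<lambda>y. frechet_derivative f (at y) (L v)"]) auto
  qed
qed

lemma Ck_on_bounded_linear:
  fixes L :: "'a::real_normed_vector \<Rightarrow> 'b::real_normed_vector"
  assumes "open S" "bounded_linear L"
  shows "Ck_on n S L"
proof (cases n)
  case 0
  then show ?thesis using assms by (simp add: linear_continuous_on)
next
  case (Suc k)
  show ?thesis unfolding Suc
    by (rule Ck_on_SucI[where f' = "\<lambda>_. L"])
      (auto intro: assms Ck_on_const bounded_linear_imp_has_derivative)
qed

lemma Ck_on_realI:
  fixes f :: "real \<Rightarrow> real"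
  assumes "open S" "\<And>x. x \<in> S \<Longrightarrow> (f has_real_derivative f' x) (at x)" "Ck_on n S f'"
  shows "Ck_on (Suc n) S f"
proof (rule Ck_on_SucI[OF assms(1)])
  show "(f has_derivative (*) (f' x)) (at x)" if "x \<in> S" for x
    using assms(2)[OF that] by (simp add: has_field_derivative_def)
  show "Ck_on n S (\<lambda>x. f' x * v)" for v
    by (intro Ck_on_mult Ck_on_const assms)
qed

lemma smooth_on_cong:
  "smooth_on S f \<Longrightarrow> open S \<Longrightarrow> (\<And>x. x \<in> S \<Longrightarrow> f x = g x) \<Longrightarrow> smooth_on S g"
  unfolding smooth_on_def using Ck_on_cong[of S f g] by blast

lemma smooth_on_subset: "smooth_on S f \<Longrightarrow> S' \<subseteq> S \<Longrightarrow> smooth_on S' f"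
  unfolding smooth_on_def using Ck_on_subset by blast

lemma smooth_on_const: "open S \<Longrightarrow> smooth_on S (\<lambda>x. c)"
  by (simp add: smooth_on_def Ck_on_const)

lemma smooth_on_add:
  "open S \<Longrightarrow> smooth_on S f \<Longrightarrow> smooth_on S g \<Longrightarrow> smooth_on S (\<lambda>x. f x + g x)"
  by (simp add: smooth_on_def Ck_on_add)

lemma smooth_on_mult:
  fixes f g :: "'a::real_normed_vector \<Rightarrow> real"
  shows "open S \<Longrightarrow> smooth_on S f \<Longrightarrow> smooth_on S g \<Longrightarrow> smooth_on S (\<lambda>x. f x * g x)"
  by (simp add: smooth_on_def Ck_on_mult)

lemma smooth_on_diff:
  fixes f g :: "'a::real_normed_vector \<Rightarrow> real"
  assumes "open S" "smooth_on S f" "smooth_on S g"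
  shows "smooth_on S (\<lambda>x. f x - g x)"
  using smooth_on_add[OF assms(1,2) smooth_on_mult[OF assms(1) smooth_on_const[OF assms(1), of "-1"] assms(3)]]
  by simp

lemma smooth_on_sum:
  assumes "open S" "\<And>i. i \<in> I \<Longrightarrow> smooth_on S (f i)"
  shows "smooth_on S (\<lambda>x. \<Sum>i\<in>I. f i x)"
  using assms(2)
  by (induction I rule: infinite_finite_induct) (auto simp: smooth_on_const smooth_on_add assms(1))

lemma smooth_on_compose_real:
  fixes f :: "'a::real_normed_vector \<Rightarrow> real" and g :: "real \<Rightarrow> real"
  assumes "open S" "open T" "smooth_on T g" "smooth_on S f" "f ` S \<subseteq> T"
  shows "smooth_on S (\<lambda>x. g (f x))"
  using assms by (simp add: smooth_on_def Ck_on_compose_real)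

lemma smooth_on_compose_affine:
  assumes "open S" "smooth_on T f" "bounded_linear L" "\<And>x. x \<in> S \<Longrightarrow> c + L x \<in> T"
  shows "smooth_on S (\<lambda>x. f (c + L x))"
  using assms(2) Ck_on_compose_affine[OF assms(1) _ assms(3,4)] by (auto simp: smooth_on_def)

lemma smooth_on_compose_linear:
  assumes "open S" "smooth_on T f" "bounded_linear L" "\<And>x. x \<in> S \<Longrightarrow> L x \<in> T"
  shows "smooth_on S (\<lambda>x. f (L x))"
  using smooth_on_compose_affine[of S T f L 0] assms by simp

lemma smooth_on_bounded_linear: "open S \<Longrightarrow> bounded_linear L \<Longrightarrow> smooth_on S L"
  by (simp add: smooth_on_def Ck_on_bounded_linear)

section \<open>Smoothness of the exponential, the reciprocal and the logarithm\<close>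

lemma smooth_on_exp: "smooth_on UNIV (exp :: real \<Rightarrow> real)"
proof -
  have "Ck_on n UNIV (exp :: real \<Rightarrow> real)" for n
  proof (induction n)
    case 0
    then show ?case by (simp add: continuous_on_exp)
  next
    case (Suc n)
    show ?case by (rule Ck_on_realI[OF _ _ Suc.IH]) (auto intro: DERIV_exp)
  qed
  then show ?thesis by (simp add: smooth_on_def)
qed

lemma smooth_on_inverse: "smooth_on {0<..} (inverse :: real \<Rightarrow> real)"
proof -
  have "Ck_on n {0<..} (inverse :: real \<Rightarrow> real)" for n
  proof (induction n)
    case 0
    then show ?case by (auto intro!: continuous_intros)
  next
    case (Suc n)
    show ?case
    proof (rule Ck_on_realI)
      show "Ck_on n {0<..} (\<lambda>x::real. (-1) * (inverse x * inverse x))"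
        by (intro Ck_on_mult Ck_on_const Suc.IH) auto
    qed (auto intro!: derivative_eq_intros)
  qed
  then show ?thesis by (simp add: smooth_on_def)
qed

lemma smooth_on_ln: "smooth_on {0<..} (ln :: real \<Rightarrow> real)"
proof -
  have "Ck_on (Suc n) {0<..} (ln :: real \<Rightarrow> real)" for n
    by (rule Ck_on_realI[of _ _ inverse])
      (use smooth_on_inverse in \<open>auto simp: smooth_on_def DERIV_ln\<close>)
  then show ?thesis unfolding smooth_on_def using Ck_on_Suc_imp by blast
qed

section \<open>The Levi form through second derivatives along lines\<close>

text \<open>The 2-jet at 0 of a function of one real variable. Restricting to lines and applying the
  rules below computes Hessians of composite functions from one-variable calculus. The filter
  \<open>nhds 0\<close> includes the point 0 itself, so \<open>p\<close> is the derivative of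
  \<open>f\<close> there.\<close>

definition second_order :: "(real \<Rightarrow> real) \<Rightarrow> real \<Rightarrow> real \<Rightarrow> bool" where
  "second_order f p q \<longleftrightarrow> (\<exists>f'. (\<forall>\<^sub>F t in nhds 0. (f has_real_derivative f' t) (at t)) \<and>
     f' 0 = p \<and> (f' has_real_derivative q) (at 0))"

text \<open>Two candidates for \<open>f'\<close> agree near 0, hence have the same derivative at 0.
  Hessians are later identified by comparing two jets of the same function: the abstract one from
  \<open>second_order_line\<close> and one assembled by the rules.\<close>

lemma second_order_unique:
  assumes "second_order f p q" "second_order f p' q'"
  shows "p = p' \<and> q = q'"
proof -
  obtain g where g: "\<forall>\<^sub>F t in nhds 0. (f has_real_derivative g t) (at t)" "g 0 = p"
    "(g has_real_derivative q) (at 0)" using assms(1) unfolding second_order_def by blast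
  obtain h where h: "\<forall>\<^sub>F t in nhds 0. (f has_real_derivative h t) (at t)" "h 0 = p'"
    "(h has_real_derivative q') (at 0)" using assms(2) unfolding second_order_def by blast
  have ev: "\<forall>\<^sub>F t in nhds 0. g t = h t"
    using g(1) h(1) by eventually_elim (rule DERIV_unique)
  then have "g 0 = h 0" by (rule eventually_nhds_x_imp_x)
  moreover have "(h has_real_derivative q) (at 0)"
    using DERIV_cong_ev[OF refl ev refl, of q] g(3) by simp
  ultimately show ?thesis using g h DERIV_unique by blast
qed

lemma second_order_const: "second_order (\<lambda>t. c) 0 0"
  unfolding second_order_def by (intro exI[of _ "\<lambda>_. 0"]) (auto intro: derivative_eq_intros)

lemma second_order_add:
  assumes "second_order f p q" "second_order g p' q'"
  shows "second_order (\<lambda>t. f t + g t) (p + p') (q + q')"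
proof -
  obtain f' where f: "\<forall>\<^sub>F t in nhds 0. (f has_real_derivative f' t) (at t)" "f' 0 = p"
    "(f' has_real_derivative q) (at 0)" using assms(1) unfolding second_order_def by blast
  obtain g' where g: "\<forall>\<^sub>F t in nhds 0. (g has_real_derivative g' t) (at t)" "g' 0 = p'"
    "(g' has_real_derivative q') (at 0)" using assms(2) unfolding second_order_def by blast
  have "\<forall>\<^sub>F t in nhds 0. ((\<lambda>t. f t + g t) has_real_derivative f' t + g' t) (at t)"
    using f(1) g(1) by eventually_elim (rule DERIV_add)
  then show ?thesis unfolding second_order_def
    by (intro exI[of _ "\<lambda>t. f' t + g' t"]) (use f g in \<open>auto intro: DERIV_add\<close>)
qed

lemma second_order_mult:
  assumes "second_order f p q" "second_order g p' q'"
  shows "second_order (\<lambda>t. f t * g t) (p * g 0 + f 0 * p') (q * g 0 + 2 * p * p' + f 0 * q')"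
proof -
  obtain f' where f: "\<forall>\<^sub>F t in nhds 0. (f has_real_derivative f' t) (at t)" "f' 0 = p"
    "(f' has_real_derivative q) (at 0)" using assms(1) unfolding second_order_def by blast
  obtain g' where g: "\<forall>\<^sub>F t in nhds 0. (g has_real_derivative g' t) (at t)" "g' 0 = p'"
    "(g' has_real_derivative q') (at 0)" using assms(2) unfolding second_order_def by blast
  have fg: "(f has_real_derivative p) (at 0)" "(g has_real_derivative p') (at 0)"
    using eventually_nhds_x_imp_x[OF f(1)] eventually_nhds_x_imp_x[OF g(1)] f g by auto
  have "\<forall>\<^sub>F t in nhds 0. ((\<lambda>t. f t * g t) has_real_derivative f' t * g t + f t * g' t) (at t)"
    using f(1) g(1) by eventually_elim (auto intro!: derivative_eq_intros)
  moreover have "((\<lambda>t. f' t * g t + f t * g' t) has_real_derivative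
      q * g 0 + 2 * p * p' + f 0 * q') (at 0)"
    using f g fg by (auto intro!: derivative_eq_intros)
  ultimately show ?thesis unfolding second_order_def
    by (intro exI[of _ "\<lambda>t. f' t * g t + f t * g' t"]) (use f g in auto)
qed

lemma second_order_cmult:
  assumes "second_order f p q"
  shows "second_order (\<lambda>t. c * f t) (c * p) (c * q)"
  using second_order_mult[OF second_order_const[of c] assms] by simp

lemma second_order_compose:
  assumes "second_order f p q" "open T" "f 0 \<in> T"
    and "\<And>x. x \<in> T \<Longrightarrow> (g has_real_derivative g' x) (at x)"
    and "(g' has_real_derivative g2) (at (f 0))"
  shows "second_order (\<lambda>t. g (f t)) (g' (f 0) * p) (g2 * p\<^sup>2 + g' (f 0) * q)"
proof -
  obtain f' where f: "\<forall>\<^sub>F t in nhds 0. (f has_real_derivative f' t) (at t)" "f' 0 = p"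
    "(f' has_real_derivative q) (at 0)" using assms(1) unfolding second_order_def by blast
  have f0: "(f has_real_derivative p) (at 0)"
    using eventually_nhds_x_imp_x[OF f(1)] f by auto
  then have "isCont f 0" by (rule DERIV_isCont)
  then have "\<forall>\<^sub>F t in nhds 0. f t \<in> T"
    using assms(2,3) by (auto simp: continuous_within tendsto_at_iff_tendsto_nhds topological_tendstoD)
  with f(1) have "\<forall>\<^sub>F t in nhds 0. ((\<lambda>t. g (f t)) has_real_derivative g' (f t) * f' t) (at t)"
    by eventually_elim (auto intro: DERIV_chain2 assms(4))
  moreover have "((\<lambda>t. g' (f t) * f' t) has_real_derivative g2 * p\<^sup>2 + g' (f 0) * q) (at 0)"
  proof -
    have "((\<lambda>t. g' (f t)) has_real_derivative g2 * p) (at 0)"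
      using DERIV_chain2[of g' g2 f 0 p] f0 assms(5) by simp
    from DERIV_mult[OF this f(3)] show ?thesis using f(2) by (simp add: power2_eq_square algebra_simps)
  qed
  ultimately show ?thesis unfolding second_order_def
    by (intro exI[of _ "\<lambda>t. g' (f t) * f' t"]) (use f in auto)
qed

lemma second_order_norm_square:
  fixes z w :: "'a::real_inner"
  shows "second_order (\<lambda>t. (norm (z + t *\<^sub>R w))\<^sup>2) (2 * inner z w) (2 * (norm w)\<^sup>2)"
proof -
  have e: "(norm (z + t *\<^sub>R w))\<^sup>2 = (norm z)\<^sup>2 + 2 * t * inner z w + t\<^sup>2 * (norm w)\<^sup>2" for t
    unfolding power2_norm_eq_inner by (simp add: algebra_simps inner_commute power2_eq_square)
  show ?thesis unfolding second_order_def e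
    by (intro exI[of _ "\<lambda>t. 2 * inner z w + 2 * t * (norm w)\<^sup>2"])
      (auto intro!: always_eventually derivative_eq_intros)
qed

definition hess :: "('a::real_normed_vector \<Rightarrow> real) \<Rightarrow> 'a \<Rightarrow> 'a \<Rightarrow> 'a \<Rightarrow> real" where
  "hess u z v w = frechet_derivative (\<lambda>x. frechet_derivative u (at x) w) (at z) v"

lemma smooth_on_derivatives:
  assumes "smooth_on S u" "z \<in> S"
  shows "(u has_derivative frechet_derivative u (at z)) (at z)"
    and "((\<lambda>x. frechet_derivative u (at x) w) has_derivative (\<lambda>v. hess u z v w)) (at z)"
proof -
  have C: "Ck_on (Suc (Suc 0)) S u" using assms(1) by (simp only: smooth_on_def)
  show "(u has_derivative frechet_derivative u (at z)) (at z)"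
    using C assms(2) by (rule Ck_on_SucD)
  have "Ck_on (Suc 0) S (\<lambda>x. frechet_derivative u (at x) w)" using C by simp
  then show "((\<lambda>x. frechet_derivative u (at x) w) has_derivative (\<lambda>v. hess u z v w)) (at z)"
    using assms(2) unfolding hess_def by (rule Ck_on_SucD)
qed

lemma second_order_line:
  assumes "open S" "smooth_on S u" "z \<in> S"
  shows "second_order (\<lambda>t. u (z + t *\<^sub>R w)) (frechet_derivative u (at z) w) (hess u z w w)"
proof -
  have line: "((\<lambda>t. f (z + t *\<^sub>R w)) has_real_derivative f' w) (at t)"
    if "(f has_derivative f') (at (z + t *\<^sub>R w))" for f f' and t :: real
  proof -
    have "((\<lambda>t. z + t *\<^sub>R w) has_derivative (\<lambda>s. s *\<^sub>R w)) (at t)"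
      by (auto intro!: derivative_eq_intros)
    from diff_chain_at[OF this that]
    have "((\<lambda>t. f (z + t *\<^sub>R w)) has_derivative (\<lambda>s. f' (s *\<^sub>R w))) (at t)"
      by (simp add: o_def)
    also have "(\<lambda>s. f' (s *\<^sub>R w)) = (*) (f' w)"
      using linear_cmul[OF has_derivative_linear[OF that], of _ w] by (simp add: fun_eq_iff)
    finally show ?thesis by (simp add: has_field_derivative_def)
  qed
  have "((\<lambda>t. z + t *\<^sub>R w) \<longlongrightarrow> z + 0 *\<^sub>R w) (nhds 0)"
    by (intro tendsto_intros filterlim_ident)
  then have "\<forall>\<^sub>F t in nhds 0. z + t *\<^sub>R w \<in> S"
    using assms(1,3) by (auto dest: topological_tendstoD)
  then have "\<forall>\<^sub>F t in nhds 0. ((\<lambda>t. u (z + t *\<^sub>R w)) has_real_derivative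
      frechet_derivative u (at (z + t *\<^sub>R w)) w) (at t)"
    by eventually_elim (intro line smooth_on_derivatives(1)[OF assms(2)])
  moreover have "((\<lambda>t. frechet_derivative u (at (z + t *\<^sub>R w)) w) has_real_derivative hess u z w w) (at 0)"
    using line[of "\<lambda>x. frechet_derivative u (at x) w" "\<lambda>v. hess u z v w" 0]
      smooth_on_derivatives(2)[OF assms(2,3), of w] by simp
  ultimately show ?thesis unfolding second_order_def
    by (intro exI[of _ "\<lambda>t. frechet_derivative u (at (z + t *\<^sub>R w)) w"]) auto
qed

text \<open>Linearity in \<open>v\<close> is that of a derivative. For \<open>w\<close>, the inner
  derivative is linear in \<open>w\<close> at every point of the open set, so both sides of each
  linearity law are derivatives at \<open>z\<close> of the same function, and derivatives are
  unique.\<close>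

lemma hess_bilinear:
  fixes z :: "'a::euclidean_space"
  assumes "open S" "smooth_on S u" "z \<in> S"
  shows "linear (\<lambda>v. hess u z v w)" and "linear (\<lambda>w. hess u z v w)"
proof -
  show "linear (\<lambda>v. hess u z v w)" for w
    using smooth_on_derivatives(2)[OF assms(2,3)] by (rule has_derivative_linear)
  have lin: "linear (frechet_derivative u (at x))" if "x \<in> S" for x
    using smooth_on_derivatives(1)[OF assms(2) that] by (rule has_derivative_linear)
  show "linear (\<lambda>w. hess u z v w)"
  proof (rule linearI)
    fix w w' and r :: real
    have "((\<lambda>x. frechet_derivative u (at x) w + frechet_derivative u (at x) w') has_derivative
        (\<lambda>v. hess u z v w + hess u z v w')) (at z)"
      using smooth_on_derivatives(2)[OF assms(2,3)] by (intro derivative_intros)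
    then have "((\<lambda>x. frechet_derivative u (at x) (w + w')) has_derivative
        (\<lambda>v. hess u z v w + hess u z v w')) (at z)"
      by (rule has_derivative_transform_within_open[OF _ assms(1,3)]) (simp add: linear_add[OF lin])
    from has_derivative_unique[OF this smooth_on_derivatives(2)[OF assms(2,3)]]
    show "hess u z v (w + w') = hess u z v w + hess u z v w'" by (simp add: fun_eq_iff)
    have "((\<lambda>x. r *\<^sub>R frechet_derivative u (at x) w) has_derivative
        (\<lambda>v. r *\<^sub>R hess u z v w)) (at z)"
      using smooth_on_derivatives(2)[OF assms(2,3)] by (intro derivative_intros)
    then have "((\<lambda>x. frechet_derivative u (at x) (r *\<^sub>R w)) has_derivative
        (\<lambda>v. r *\<^sub>R hess u z v w)) (at z)"
      by (rule has_derivative_transform_within_open[OF _ assms(1,3)]) (simp add: linear_cmul[OF lin])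
    from has_derivative_unique[OF this smooth_on_derivatives(2)[OF assms(2,3)]]
    show "hess u z v (r *\<^sub>R w) = r *\<^sub>R hess u z v w" by (simp add: fun_eq_iff)
  qed
qed

lemma d_z_d_zbar:
  assumes "open S" "smooth_on S u" "z \<in> S"
  shows "d_z j (d_zbar k (\<lambda>x. complex_of_real (u x))) z =
    (complex_of_real (hess u z (axis j 1) (axis k 1)) + \<i> * hess u z (axis j 1) (axis k \<i>)
     - \<i> * (hess u z (axis j \<i>) (axis k 1) + \<i> * hess u z (axis j \<i>) (axis k \<i>))) / 4"
proof -
  have 1: "frechet_derivative (\<lambda>x. complex_of_real (u x)) (at x) =
      (\<lambda>v. complex_of_real (frechet_derivative u (at x) v))" if "x \<in> S" for x
    using smooth_on_derivatives(1)[OF assms(2) that]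
    by (intro frechet_derivative_at[symmetric]) (rule derivative_intros)
  let ?f = "\<lambda>x. (complex_of_real (frechet_derivative u (at x) (axis k 1))
      + \<i> * frechet_derivative u (at x) (axis k \<i>)) / 2"
  let ?f' = "\<lambda>v. (complex_of_real (hess u z v (axis k 1)) + \<i> * hess u z v (axis k \<i>)) / 2"
  have "(?f has_derivative ?f') (at z)"
    using smooth_on_derivatives(2)[OF assms(2,3)] by (auto intro!: derivative_eq_intros)
  then have "(d_zbar k (\<lambda>x. complex_of_real (u x)) has_derivative ?f') (at z)"
    by (rule has_derivative_transform_within_open[OF _ assms(1,3)]) (simp add: d_zbar_def 1)
  from frechet_derivative_at[OF this, symmetric]
  show ?thesis unfolding d_z_def by (simp add: field_simps)
qed

text \<open>The right side is the Laplacian of \<open>u\<close> along the complex line through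
  \<open>z\<close> in direction \<open>w\<close>. After \<open>w\<close> and
  \<open>\<i> *s w\<close> are expanded in the real basis \<open>axis j 1\<close>,
  \<open>axis j \<i>\<close>, the two sides agree for each pair \<open>j\<close>, \<open>k\<close>
  separately.\<close>

lemma levi_form_eq_hess:
  fixes u :: "complex ^ 'n::finite \<Rightarrow> real"
  assumes "open S" "smooth_on S u" "z \<in> S"
  shows "4 * Re (\<Sum>j\<in>UNIV. \<Sum>k\<in>UNIV.
      d_z j (d_zbar k (\<lambda>x. complex_of_real (u x))) z * (w $ j) * cnj (w $ k))
    = hess u z w w + hess u z (\<i> *s w) (\<i> *s w)"
proof -
  define H where "H = hess u z"
  have L1: "linear (\<lambda>v. H v w)" and L2: "linear (H v)" for v w
    unfolding H_def using hess_bilinear[OF assms] by auto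
  have expand: "v = (\<Sum>j\<in>UNIV. Re (v $ j) *\<^sub>R axis j 1 + Im (v $ j) *\<^sub>R axis j \<i>)" for v :: "complex ^ 'n"
  proof -
    have "(\<Sum>j\<in>UNIV. (Re (v $ j) *\<^sub>R axis j 1 + Im (v $ j) *\<^sub>R axis j \<i>) $ i) = v $ i" for i
    proof -
      have "(\<Sum>j\<in>UNIV. (Re (v $ j) *\<^sub>R axis j 1 + Im (v $ j) *\<^sub>R axis j \<i>) $ i)
        = (\<Sum>j\<in>UNIV. if j = i then v $ i else 0)"
        by (rule sum.cong) (auto simp: axis_def complex_eq_iff)
      then show ?thesis by simp
    qed
    then show ?thesis by (simp add: vec_eq_iff)
  qed
  have sq: "H v v = (\<Sum>j\<in>UNIV. \<Sum>k\<in>UNIV.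
      Re (v $ j) * Re (v $ k) * H (axis j 1) (axis k 1) + Re (v $ j) * Im (v $ k) * H (axis j 1) (axis k \<i>)
    + Im (v $ j) * Re (v $ k) * H (axis j \<i>) (axis k 1) + Im (v $ j) * Im (v $ k) * H (axis j \<i>) (axis k \<i>))" for v
  proof -
    have "H v v = (\<Sum>j\<in>UNIV. Re (v $ j) * H (axis j 1) v + Im (v $ j) * H (axis j \<i>) v)"
      by (subst expand[of v], subst linear_sum[OF L1])
        (simp add: linear_add[OF L1] linear_cmul[OF L1] flip: expand[of v])
    moreover have "H x v = (\<Sum>k\<in>UNIV. Re (v $ k) * H x (axis k 1) + Im (v $ k) * H x (axis k \<i>))" for x
      by (subst expand[of v], subst linear_sum[OF L2])
        (simp add: linear_add[OF L2] linear_cmul[OF L2])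
    ultimately show ?thesis
      by (simp add: sum_distrib_left sum.distrib algebra_simps)
  qed
  show ?thesis
    unfolding d_z_d_zbar[OF assms] H_def[symmetric] sq
    unfolding Re_sum sum_distrib_left sum.distrib[symmetric]
    by (intro sum.cong refl) (simp add: field_simps)
qed

lemma strongly_psh_on_iff:
  fixes u :: "complex ^ 'n::finite \<Rightarrow> real"
  assumes "open S"
  shows "strongly_psh_on S u \<longleftrightarrow> smooth_on S u \<and>
    (\<forall>z\<in>S. \<forall>w. w \<noteq> 0 \<longrightarrow> 0 < hess u z w w + hess u z (\<i> *s w) (\<i> *s w))"
  unfolding strongly_psh_on_def levi_form_eq_hess[OF assms, symmetric]
  by (auto simp flip: levi_form_eq_hess[OF assms])


section \<open>Splitting coordinates into base and fiber; the norms |t|^2 exp(\<phi>)\<close>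

definition base_part :: "complex ^ ('n::finite + 'k::finite) \<Rightarrow> complex ^ 'n" where
  "base_part y = (\<chi> i. y $ Inl i)"

definition fiber_part :: "complex ^ ('n::finite + 'k::finite) \<Rightarrow> complex ^ 'k" where
  "fiber_part y = (\<chi> i. y $ Inr i)"

definition vec_append :: "complex ^ 'n::finite \<Rightarrow> complex ^ 'k::finite \<Rightarrow> complex ^ ('n + 'k)" where
  "vec_append a b = (\<chi> i. case i of Inl j \<Rightarrow> a $ j | Inr j \<Rightarrow> b $ j)"

lemma vec_append_parts [simp]:
  "base_part (vec_append a b) = a" "fiber_part (vec_append a b) = b"
  "vec_append (base_part y) (fiber_part y) = y"
  by (auto simp: base_part_def fiber_part_def vec_append_def vec_eq_iff split: sum.split)

lemma vec_append_nth [simp]: "vec_append a b $ Inl i = a $ i" "vec_append a b $ Inr j = b $ j"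
  by (simp_all add: vec_append_def)

lemma part_nth [simp]: "base_part y $ i = y $ Inl i" "fiber_part y $ j = y $ Inr j"
  by (simp_all add: base_part_def fiber_part_def)

lemma parts_linear [simp]:
  "base_part (y + y') = base_part y + base_part y'" "base_part (c *\<^sub>R y) = c *\<^sub>R base_part y"
  "base_part (d *s y) = d *s base_part y"
  "fiber_part (y + y') = fiber_part y + fiber_part y'" "fiber_part (c *\<^sub>R y) = c *\<^sub>R fiber_part y"
  "fiber_part (d *s y) = d *s fiber_part y"
  by (simp_all add: vec_eq_iff)

lemma parts_zero_iff: "y = 0 \<longleftrightarrow> base_part y = 0 \<and> fiber_part y = 0"
proof
  assume "base_part y = 0 \<and> fiber_part y = 0"
  then have "y $ i = 0" for i by (cases i) (auto simp: vec_eq_iff)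
  then show "y = 0" by (simp add: vec_eq_iff)
qed (auto simp: vec_eq_iff)

lemma bounded_linear_parts: "bounded_linear base_part" "bounded_linear fiber_part"
  unfolding linear_conv_bounded_linear[symmetric] by (auto intro!: linearI)

lemma continuous_on_parts: "continuous_on S base_part" "continuous_on S fiber_part"
  by (simp_all add: linear_continuous_on bounded_linear_parts)

lemma open_vimage_base_part: "open \<Omega> \<Longrightarrow> open {y. base_part y \<in> \<Omega>}"
  using open_vimage[of \<Omega> base_part] continuous_on_parts(1)[of UNIV] by (simp add: vimage_def)

lemma open_off_zero: "open \<Omega> \<Longrightarrow> open {y :: complex ^ ('n::finite + 1). base_part y \<in> \<Omega> \<and> y $ Inr 1 \<noteq> 0}"
  unfolding Collect_conj_eq
  by (intro open_Int open_vimage_base_part open_Collect_neq continuous_intros)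

text \<open>\<open>Inr 1\<close> indexes the single fiber coordinate t. This is a hermitian metric
  on a line bundle in a trivialization; for the dual of O(1) the weight will be minus the logarithm
  of the metric at the frame vector.\<close>

definition weighted_norm :: "(complex ^ 'n::finite \<Rightarrow> real) \<Rightarrow> complex ^ ('n + 1) \<Rightarrow> real" where
  "weighted_norm \<phi> y = (cmod (y $ Inr 1))\<^sup>2 * exp (\<phi> (base_part y))"

lemma smooth_on_norm_square:
  assumes "open S"
  shows "smooth_on S (\<lambda>y :: complex ^ 'n::finite. (norm y)\<^sup>2)"
proof -
  have "smooth_on S (\<lambda>y. \<Sum>i\<in>UNIV. Re (y $ i) * Re (y $ i) + Im (y $ i) * Im (y $ i))"
    by (intro smooth_on_sum smooth_on_add smooth_on_mult smooth_on_bounded_linear assms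
        bounded_linear_compose[OF bounded_linear_Re bounded_linear_vec_nth]
        bounded_linear_compose[OF bounded_linear_Im bounded_linear_vec_nth])
  also have "(\<lambda>y. \<Sum>i\<in>UNIV. Re (y $ i) * Re (y $ i) + Im (y $ i) * Im (y $ i)) =
      (\<lambda>y :: complex ^ 'n. (norm y)\<^sup>2)"
    by (simp add: norm_vec_def L2_set_def sum_nonneg cmod_def power2_eq_square)
  finally show ?thesis .
qed

lemma smooth_on_weighted_norm:
  fixes \<phi> :: "complex ^ 'n::finite \<Rightarrow> real"
  assumes "open \<Omega>" "smooth_on \<Omega> \<phi>"
  shows "smooth_on {y. base_part y \<in> \<Omega>} (weighted_norm \<phi>)"
proof -
  let ?S = "{y :: complex ^ ('n + 1). base_part y \<in> \<Omega>}"
  have o: "open ?S" by (rule open_vimage_base_part[OF assms(1)])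
  have n: "(norm (fiber_part y))\<^sup>2 = (cmod (y $ Inr 1))\<^sup>2" for y :: "complex ^ ('n + 1)"
    by (simp add: norm_vec_def L2_set_def)
  have "smooth_on ?S (\<lambda>y. (norm (fiber_part y))\<^sup>2 * exp (\<phi> (base_part y)))"
    by (intro smooth_on_mult smooth_on_compose_real[OF _ open_UNIV smooth_on_exp] o
        smooth_on_compose_linear[OF _ assms(2)] smooth_on_compose_linear[OF _ smooth_on_norm_square[OF open_UNIV]]
        bounded_linear_parts) auto
  then show ?thesis unfolding weighted_norm_def n .
qed

lemma hess_weighted_norm:
  fixes \<phi> :: "complex ^ 'n::finite \<Rightarrow> real"
  assumes "open \<Omega>" "smooth_on \<Omega> \<phi>" "base_part y \<in> \<Omega>"
  shows "hess (weighted_norm \<phi>) y w w = exp (\<phi> (base_part y)) *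
    (2 * (cmod (w $ Inr 1))\<^sup>2 + 4 * inner (y $ Inr 1) (w $ Inr 1) * frechet_derivative \<phi> (at (base_part y)) (base_part w)
     + (cmod (y $ Inr 1))\<^sup>2 * ((frechet_derivative \<phi> (at (base_part y)) (base_part w))\<^sup>2
        + hess \<phi> (base_part y) (base_part w) (base_part w)))"
proof -
  have y: "y \<in> {y. base_part y \<in> \<Omega>}" using assms(3) by simp
  note 1 = second_order_line[OF open_vimage_base_part[OF assms(1)] smooth_on_weighted_norm[OF assms(1,2)] y, of w]
  note \<phi> = second_order_line[OF assms, of "base_part w"]
  note e = second_order_compose[OF \<phi> open_UNIV UNIV_I DERIV_exp DERIV_exp]
  note m = second_order_mult[OF second_order_norm_square[of "y $ Inr 1" "w $ Inr 1"] e]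
  have "(\<lambda>t. (cmod (y $ Inr 1 + t *\<^sub>R w $ Inr 1))\<^sup>2 * exp (\<phi> (base_part y + t *\<^sub>R base_part w))) =
    (\<lambda>t. weighted_norm \<phi> (y + t *\<^sub>R w))"
    by (simp add: weighted_norm_def fun_eq_iff)
  from second_order_unique[OF 1 m[unfolded this]]
  show ?thesis by (simp add: algebra_simps)
qed

text \<open>Completing the square. \<open>D\<close> is twice the complex derivative of \<phi> in
  direction \<open>v\<close>, so the square vanishes exactly on the horizontal vectors of the Chern
  connection. What remains is |t|^2 times the Levi form of the weight.\<close>

lemma levi_weighted_norm:
  fixes \<phi> :: "complex ^ 'n::finite \<Rightarrow> real" and w :: "complex ^ ('n + 1)"
  assumes "open \<Omega>" "smooth_on \<Omega> \<phi>" "base_part y \<in> \<Omega>"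
  defines "b \<equiv> base_part y" and "v \<equiv> base_part w"
  defines "D \<equiv> Complex (frechet_derivative \<phi> (at b) v) (- frechet_derivative \<phi> (at b) (\<i> *s v))"
  shows "hess (weighted_norm \<phi>) y w w + hess (weighted_norm \<phi>) y (\<i> *s w) (\<i> *s w) =
    exp (\<phi> b) * ((cmod (2 * w $ Inr 1 + y $ Inr 1 * D))\<^sup>2 +
      (cmod (y $ Inr 1))\<^sup>2 * (hess \<phi> b v v + hess \<phi> b (\<i> *s v) (\<i> *s v)))"
proof -
  define p1 p2 where "p1 = frechet_derivative \<phi> (at b) v" "p2 = frechet_derivative \<phi> (at b) (\<i> *s v)"
  define q1 q2 where "q1 = hess \<phi> b v v" "q2 = hess \<phi> b (\<i> *s v) (\<i> *s v)"
  have id: "E * (2 * (cmod \<tau>)\<^sup>2 + 4 * inner t \<tau> * p1 + (cmod t)\<^sup>2 * (p1\<^sup>2 + q1))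
     + E * (2 * (cmod (\<i> * \<tau>))\<^sup>2 + 4 * inner t (\<i> * \<tau>) * p2 + (cmod t)\<^sup>2 * (p2\<^sup>2 + q2))
    = E * ((cmod (2 * \<tau> + t * Complex p1 (- p2)))\<^sup>2 + (cmod t)\<^sup>2 * (q1 + q2))" for E t \<tau>
    unfolding cmod_power2 inner_complex_def by (simp add: algebra_simps power2_eq_square)
  show ?thesis
    unfolding hess_weighted_norm[OF assms(1-3)] D_def
    using id[of "exp (\<phi> b)" "w $ Inr 1" "y $ Inr 1"]
    by (simp add: b_def v_def p1_p2_def q1_q2_def)
qed

lemma strongly_psh_on_weighted_norm:
  fixes \<phi> :: "complex ^ 'n::finite \<Rightarrow> real"
  assumes "open \<Omega>" "strongly_psh_on \<Omega> \<phi>"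
  shows "strongly_psh_on {y. base_part y \<in> \<Omega> \<and> y $ Inr 1 \<noteq> 0} (weighted_norm \<phi>)"
  unfolding strongly_psh_on_iff[OF open_off_zero[OF assms(1)]]
proof (intro conjI ballI allI impI)
  have sm: "smooth_on \<Omega> \<phi>" and pos: "\<And>z w. z \<in> \<Omega> \<Longrightarrow> w \<noteq> 0 \<Longrightarrow> 0 < hess \<phi> z w w + hess \<phi> z (\<i> *s w) (\<i> *s w)"
    using assms by (auto simp: strongly_psh_on_iff)
  show "smooth_on {y. base_part y \<in> \<Omega> \<and> y $ Inr 1 \<noteq> 0} (weighted_norm \<phi>)"
    by (rule smooth_on_subset[OF smooth_on_weighted_norm[OF assms(1) sm]]) auto
  fix y w :: "complex ^ ('n + 1)"
  assume y: "y \<in> {y. base_part y \<in> \<Omega> \<and> y $ Inr 1 \<noteq> 0}" and w: "w \<noteq> 0"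
  show "0 < hess (weighted_norm \<phi>) y w w + hess (weighted_norm \<phi>) y (\<i> *s w) (\<i> *s w)"
  proof (cases "base_part w = 0")
    case False
    then show ?thesis using y pos[of "base_part y" "base_part w"] levi_weighted_norm[OF assms(1) sm, of y w]
      by (simp add: add_nonneg_pos)
  next
    \<comment> \<open>A vertical direction: the first and second derivatives of \<phi> contribute
      nothing, and the square is positive because the fiber component of \<open>w\<close> cannot
      vanish as well.\<close>
    case True
    have l: "linear (frechet_derivative \<phi> (at (base_part y)))"
      using smooth_on_derivatives(1)[OF sm, of "base_part y"] y by (auto intro: has_derivative_linear)
    have h: "hess \<phi> (base_part y) 0 0 = 0"
      using linear_0[OF hess_bilinear(1)[OF assms(1) sm, of "base_part y" 0]] y by auto
    have "w $ Inr 1 \<noteq> 0" 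
    proof
      assume "w $ Inr 1 = 0"
      then have "fiber_part w = 0" by (auto simp: vec_eq_iff)
      then show False using True w by (simp add: parts_zero_iff)
    qed
    then show ?thesis using y True levi_weighted_norm[OF assms(1) sm, of y w] linear_0[OF l] h
      by (simp add: complex_eq_iff)
  qed
qed

text \<open>To see the weight alone, the square in \<open>levi_weighted_norm\<close> has to
  disappear. Every base direction has a horizontal lift on which it does, and positivity of the
  total Levi form on that lift is positivity for \<phi>.\<close>

lemma strongly_psh_on_weightD:
  fixes \<phi> :: "complex ^ 'n::finite \<Rightarrow> real"
  assumes "smooth_on UNIV (weighted_norm \<phi>)"
    and "strongly_psh_on {y. y $ Inr 1 \<noteq> 0} (weighted_norm \<phi>)"
  shows "strongly_psh_on UNIV \<phi>"
proof -
  let ?L = "\<lambda>z :: complex ^ 'n. vec_append z 0 :: complex ^ ('n + 1)"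
  have L: "bounded_linear ?L"
    unfolding linear_conv_bounded_linear[symmetric] by (rule linearI) (simp_all add: vec_append_def vec_eq_iff split: sum.split)
  \<comment> \<open>On the slice t = 1 the logarithm of the weighted norm is \<phi>, so smoothness
    descends to the weight.\<close>
  have "smooth_on UNIV (\<lambda>z. ln (weighted_norm \<phi> (vec_append 0 1 + ?L z)))"
    by (intro smooth_on_compose_real[OF _ _ smooth_on_ln] smooth_on_compose_affine[OF _ assms(1) L])
      (auto simp: weighted_norm_def)
  also have "(\<lambda>z. ln (weighted_norm \<phi> (vec_append 0 1 + ?L z))) = \<phi>"
    by (simp add: weighted_norm_def fun_eq_iff)
  finally have sm: "smooth_on UNIV \<phi>" .
  have op: "open {y :: complex ^ ('n + 1). y $ Inr 1 \<noteq> 0}"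
    by (auto intro!: open_Collect_neq continuous_intros)
  have "0 < hess \<phi> z w w + hess \<phi> z (\<i> *s w) (\<i> *s w)" if "w \<noteq> 0" for z w
  proof -
    define D where "D = Complex (frechet_derivative \<phi> (at z) w) (- frechet_derivative \<phi> (at z) (\<i> *s w))"
    let ?y = "vec_append z 1 :: complex ^ ('n + 1)"
    \<comment> \<open>The horizontal lift of \<open>w\<close> at t = 1: the fiber component - D / 2
      cancels the square.\<close>
    let ?w = "vec_append w (\<chi> _. - D / 2) :: complex ^ ('n + 1)"
    have "?w \<noteq> 0" using that by (auto simp: parts_zero_iff)
    then have "0 < hess (weighted_norm \<phi>) ?y ?w ?w + hess (weighted_norm \<phi>) ?y (\<i> *s ?w) (\<i> *s ?w)"
      using assms(2) unfolding strongly_psh_on_iff[OF op] by simp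
    then show ?thesis
      unfolding levi_weighted_norm[OF open_UNIV sm UNIV_I] by (simp add: D_def zero_less_mult_iff)
  qed
  then show ?thesis using sm by (simp add: strongly_psh_on_iff)
qed

text \<open>With c = \<gamma>'(v - u) in [0, 1] the Hessian is c Hess v + (1 - c) Hess u plus the
  nonnegative term \<gamma>2 (dv - du)^2. So monotonicity, slope at most 1 and convexity of \<gamma>
  turn two positive Levi forms into a convex combination of them plus something nonnegative.\<close>

lemma strongly_psh_on_regularized_max:
  fixes u v :: "complex ^ 'n::finite \<Rightarrow> real" and \<gamma> :: "real \<Rightarrow> real"
  assumes "open S" "strongly_psh_on S u" "strongly_psh_on S v"
    and "smooth_on UNIV \<gamma>" "\<And>x. (\<gamma> has_real_derivative \<gamma>' x) (at x)"
    and "\<And>x. (\<gamma>' has_real_derivative \<gamma>2 x) (at x)"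
    and "\<And>x. 0 \<le> \<gamma>' x" "\<And>x. \<gamma>' x \<le> 1" "\<And>x. 0 \<le> \<gamma>2 x"
  shows "strongly_psh_on S (\<lambda>z. u z + \<gamma> (v z - u z))"
  unfolding strongly_psh_on_iff[OF assms(1)]
proof (intro conjI ballI allI impI)
  note u = assms(2)[unfolded strongly_psh_on_iff[OF assms(1)]]
  note v = assms(3)[unfolded strongly_psh_on_iff[OF assms(1)]]
  have su: "smooth_on S u" and sv: "smooth_on S v" using u v by auto
  show sm: "smooth_on S (\<lambda>z. u z + \<gamma> (v z - u z))"
    by (intro smooth_on_add smooth_on_compose_real[OF _ open_UNIV assms(4)] smooth_on_diff su sv assms(1)) auto
  fix z w :: "complex ^ 'n"
  assume z: "z \<in> S" and w: "w \<noteq> 0"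
  let ?c = "\<gamma>' (v z - u z)"
  have h: "\<exists>p. hess (\<lambda>z. u z + \<gamma> (v z - u z)) z w w =
    \<gamma>2 (v z - u z) * p\<^sup>2 + ?c * hess v z w w + (1 - ?c) * hess u z w w" for w
  proof -
    note 1 = second_order_line[OF assms(1) su z, of w]
    note 2 = second_order_add[OF second_order_line[OF assms(1) sv z, of w] second_order_cmult[OF 1, of "-1"]]
    have e: "second_order (\<lambda>t. v (z + t *\<^sub>R w) + - 1 * u (z + t *\<^sub>R w)) p q \<Longrightarrow>
       second_order (\<lambda>t. v (z + t *\<^sub>R w) - u (z + t *\<^sub>R w)) p q" for p q by simp
    note 3 = second_order_add[OF 1 second_order_compose[OF e[OF 2] open_UNIV UNIV_I assms(5,6)]]
    from second_order_unique[OF second_order_line[OF assms(1) sm z, of w] 3]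
    show ?thesis
      by (intro exI[of _ "frechet_derivative v (at z) w - frechet_derivative u (at z) w"])
        (simp add: algebra_simps)
  qed
  obtain p q where pq: "hess (\<lambda>z. u z + \<gamma> (v z - u z)) z w w =
      \<gamma>2 (v z - u z) * p\<^sup>2 + ?c * hess v z w w + (1 - ?c) * hess u z w w"
    "hess (\<lambda>z. u z + \<gamma> (v z - u z)) z (\<i> *s w) (\<i> *s w) =
      \<gamma>2 (v z - u z) * q\<^sup>2 + ?c * hess v z (\<i> *s w) (\<i> *s w) + (1 - ?c) * hess u z (\<i> *s w) (\<i> *s w)"
    using h[of w] h[of "\<i> *s w"] by blast
  define A where "A = hess u z w w + hess u z (\<i> *s w) (\<i> *s w)"
  define B where "B = hess v z w w + hess v z (\<i> *s w) (\<i> *s w)"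
  have "A > 0" "B > 0" using u v z w by (auto simp: A_def B_def)
  \<comment> \<open>Either coefficient may vanish, but not both: for c = 0 the term with
    \<open>A\<close> is positive, otherwise the one with \<open>B\<close>.\<close>
  then have "0 < ?c * B + (1 - ?c) * A"
    using assms(7,8)[of "v z - u z"] by (cases "?c = 0") (auto intro!: add_pos_nonneg)
  moreover have "0 \<le> \<gamma>2 (v z - u z) * p\<^sup>2 + \<gamma>2 (v z - u z) * q\<^sup>2" using assms(9) by simp
  ultimately show "0 < hess (\<lambda>z. u z + \<gamma> (v z - u z)) z w w +
      hess (\<lambda>z. u z + \<gamma> (v z - u z)) z (\<i> *s w) (\<i> *s w)"
    unfolding pq A_def B_def by (simp add: algebra_simps)
qed

text \<open>Pulled back to the product, \<phi> is constant in the base directions and its Levi form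
  degenerates there; |s|^2 with a positive slope fills the gap. The constant \<open>c\<close> lets
  the radial term vanish on a chosen sphere.\<close>

lemma strongly_psh_on_add_norm_square:
  fixes \<phi> :: "complex ^ 'd::finite \<Rightarrow> real"
  assumes "strongly_psh_on UNIV \<phi>" "0 < m"
  shows "strongly_psh_on UNIV
    (\<lambda>z :: complex ^ ('m::finite + 'd). \<phi> (fiber_part z) + m * ((norm (base_part z))\<^sup>2 - c))"
    (is "strongly_psh_on UNIV ?u")
  unfolding strongly_psh_on_iff[OF open_UNIV]
proof (intro conjI ballI allI impI)
  note \<phi> = assms(1)[unfolded strongly_psh_on_iff[OF open_UNIV]]
  have s\<phi>: "smooth_on UNIV \<phi>" using \<phi> by auto
  show sm: "smooth_on UNIV ?u"
    by (intro smooth_on_add smooth_on_mult smooth_on_diff smooth_on_const smooth_on_compose_linear[OF _ s\<phi>]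
        smooth_on_compose_linear[OF _ smooth_on_norm_square[OF open_UNIV]] bounded_linear_parts) auto
  fix z w :: "complex ^ ('m + 'd)"
  assume w: "w \<noteq> 0"
  have h: "hess ?u z w w = hess \<phi> (fiber_part z) (fiber_part w) (fiber_part w) + 2 * m * (norm (base_part w))\<^sup>2" for w
  proof -
    note 1 = second_order_line[OF open_UNIV s\<phi> UNIV_I, of "fiber_part z" "fiber_part w"]
    note 2 = second_order_cmult[OF second_order_add[OF second_order_norm_square[of "base_part z" "base_part w"]
        second_order_const[of "-c"]], of m]
    note 3 = second_order_add[OF 1 2]
    have "(\<lambda>t. \<phi> (fiber_part z + t *\<^sub>R fiber_part w) + m * ((norm (base_part z + t *\<^sub>R base_part w))\<^sup>2 + - c))
        = (\<lambda>t. ?u (z + t *\<^sub>R w))" by simp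
    from second_order_unique[OF second_order_line[OF open_UNIV sm UNIV_I] 3[unfolded this]]
    show ?thesis by simp
  qed
  have ni: "norm (\<i> *s x) = norm x" for x :: "complex ^ 'm"
    by (simp add: norm_vec_def norm_mult)
  show "0 < hess ?u z w w + hess ?u z (\<i> *s w) (\<i> *s w)"
  proof (cases "fiber_part w = 0")
    case True
    then have "base_part w \<noteq> 0" using w by (simp add: parts_zero_iff)
    moreover have "hess \<phi> (fiber_part z) 0 0 = 0"
      using linear_0[OF hess_bilinear(1)[OF open_UNIV s\<phi> UNIV_I, of "fiber_part z" 0]] by simp
    ultimately show ?thesis using True assms(2) by (simp add: h ni)
  next
    case False
    then have "0 < hess \<phi> (fiber_part z) (fiber_part w) (fiber_part w)
       + hess \<phi> (fiber_part z) (\<i> *s fiber_part w) (\<i> *s fiber_part w)" using \<phi> by blast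
    moreover have "0 \<le> 4 * m * (norm (base_part w))\<^sup>2" using assms(2) by simp
    ultimately show ?thesis by (simp add: h ni)
  qed
qed

section \<open>A regularized positive part\<close>

text \<open>A family closed under differentiation: for x > 0 the derivative of p(1/x) exp(-1/x) has
  the same form with p replaced by X^2 (p - p'). Smoothness, at 0 as well, then follows by one
  induction over all \<open>p\<close>.\<close>

definition flat :: "real poly \<Rightarrow> real \<Rightarrow> real" where
  "flat p x = (if x \<le> 0 then 0 else poly p (inverse x) * exp (- inverse x))"

lemma poly_times_exp_neg_tendsto_0:
  fixes p :: "real poly"
  shows "((\<lambda>y. poly p y * exp (- y)) \<longlongrightarrow> 0) at_top"
proof -
  have "((\<lambda>y. \<Sum>i\<le>degree p. coeff p i * (y ^ i / exp y)) \<longlongrightarrow> (\<Sum>i\<le>degree p. coeff p i * 0)) at_top"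
    by (intro tendsto_intros tendsto_power_div_exp_0)
  then show ?thesis by (simp add: poly_altdef sum_distrib_right exp_minus divide_inverse mult.assoc)
qed

lemma flat_tendsto_0: "(flat p \<longlongrightarrow> 0) (at 0)"
proof (rule filterlim_split_at)
  have "((\<lambda>x. 0) \<longlongrightarrow> 0) (at_left (0::real))" by simp
  then show "(flat p \<longlongrightarrow> 0) (at_left 0)"
    by (rule Lim_transform_eventually) (auto simp: eventually_at_filter flat_def)
  have "((\<lambda>x. poly p (inverse x) * exp (- inverse x)) \<longlongrightarrow> 0) (at_right 0)"
    using filterlim_compose[OF poly_times_exp_neg_tendsto_0 filterlim_inverse_at_top_right] .
  then show "(flat p \<longlongrightarrow> 0) (at_right 0)"
    by (rule Lim_transform_eventually) (auto simp: eventually_at_filter flat_def)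
qed

lemma flat_has_derivative:
  "(flat p has_real_derivative flat ([:0, 0, 1:] * (p - pderiv p)) x) (at x)"
proof (cases x "0::real" rule: linorder_cases)
  case less
  have "((\<lambda>x. 0) has_real_derivative 0) (at x)" by simp
  then have "(flat p has_real_derivative 0) (at x)"
    by (rule has_field_derivative_transform_within_open[of _ _ _ "{..<0}"]) (use less in \<open>auto simp: flat_def\<close>)
  then show ?thesis using less by (simp add: flat_def)
next
  case equal
  have "((\<lambda>h. (flat p (0 + h) - flat p 0) / h) \<longlongrightarrow> 0) (at 0)"
  \<comment> \<open>Dividing by h multiplies the polynomial in 1/h by X, so the difference quotient
    at 0 is again a \<open>flat\<close> function and tends to 0.\<close>
  proof (rule Lim_transform_eventually[OF flat_tendsto_0[of "pCons 0 p"]])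
    show "\<forall>\<^sub>F h in at 0. flat (pCons 0 p) h = (flat p (0 + h) - flat p 0) / h"
      by (auto simp: eventually_at_filter flat_def divide_inverse)
  qed
  then show ?thesis using equal by (simp add: DERIV_def flat_def)
next
  case greater
  have "((\<lambda>x. poly p (inverse x) * exp (- inverse x)) has_real_derivative
      poly ([:0, 0, 1:] * (p - pderiv p)) (inverse x) * exp (- inverse x)) (at x)"
    using greater
    by (auto intro!: derivative_eq_intros DERIV_chain2[OF poly_DERIV] simp: power2_eq_square algebra_simps)
  then have "(flat p has_real_derivative poly ([:0, 0, 1:] * (p - pderiv p)) (inverse x) * exp (- inverse x)) (at x)"
    by (rule has_field_derivative_transform_within_open[of _ _ _ "{0<..}"]) (use greater in \<open>auto simp: flat_def\<close>)
  then show ?thesis using greater by (simp add: flat_def)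
qed

lemma smooth_on_flat: "smooth_on UNIV (flat p)"
proof -
  have "Ck_on n UNIV (flat p)" for n
  proof (induction n arbitrary: p)
    case 0
    show ?case using flat_has_derivative by (auto intro!: continuous_at_imp_continuous_on DERIV_isCont)
  next
    case (Suc n)
    show ?case by (rule Ck_on_realI[OF open_UNIV flat_has_derivative Suc.IH])
  qed
  then show ?thesis by (simp add: smooth_on_def)
qed

text \<open>The classical quotient f(x) / (f(x) + f(\<epsilon> - x)) with f(x) = exp(-1/x) for x >
  0. The denominator is positive since x and \<epsilon> - x cannot both be nonpositive.\<close>

lemma smooth_step_exists:
  fixes \<epsilon> :: real
  assumes "0 < \<epsilon>"
  shows "\<exists>\<sigma> \<sigma>' :: real \<Rightarrow> real. smooth_on UNIV \<sigma> \<and> (\<forall>x. (\<sigma> has_real_derivative \<sigma>' x) (at x)) \<and>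
    (\<forall>x. 0 \<le> \<sigma>' x) \<and> (\<forall>x. 0 \<le> \<sigma> x) \<and> (\<forall>x. \<sigma> x \<le> 1) \<and> (\<forall>x\<le>0. \<sigma> x = 0) \<and> (\<forall>x\<ge>\<epsilon>. \<sigma> x = 1)"
proof -
  define f where "f = flat 1"
  define f' where "f' = flat [:0, 0, 1:]"
  have f: "(f has_real_derivative f' x) (at x)" for x
    using flat_has_derivative[of 1] by (simp add: f_def f'_def)
  have f0: "0 \<le> f x" "0 \<le> f' x" for x by (auto simp: f_def f'_def flat_def)
  have f1: "f x = 0" if "x \<le> 0" for x using that by (simp add: f_def flat_def)
  have f2: "0 < f x" if "0 < x" for x using that by (simp add: f_def flat_def)
  define g where "g x = f x + f (\<epsilon> - x)" for x
  have g: "0 < g x" for x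
    using f2[of x] f2[of "\<epsilon> - x"] f0 assms unfolding g_def by (cases "0 < x") (auto intro: add_pos_nonneg add_nonneg_pos)
  have dfe: "((\<lambda>x. f (\<epsilon> - x)) has_real_derivative - f' (\<epsilon> - x)) (at x)" for x
  proof -
    have "((\<lambda>x. \<epsilon> - x) has_real_derivative -1) (at x)" by (auto intro!: derivative_eq_intros)
    from DERIV_chain2[OF f this] show ?thesis by simp
  qed
  have dg: "(g has_real_derivative f' x - f' (\<epsilon> - x)) (at x)" for x
    unfolding g_def using DERIV_add[OF f dfe] by simp
  define \<sigma> where "\<sigma> x = f x * inverse (g x)" for x
  define \<sigma>' where "\<sigma>' x = (f' x * f (\<epsilon> - x) + f x * f' (\<epsilon> - x)) / (g x)\<^sup>2" for x
  show ?thesis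
  proof (rule exI[of _ \<sigma>], rule exI[of _ \<sigma>'], intro conjI allI impI)
    have fl: "smooth_on UNIV f" unfolding f_def by (rule smooth_on_flat)
    have "smooth_on UNIV (\<lambda>x. f (\<epsilon> + - x))"
      using smooth_on_compose_affine[OF open_UNIV fl, of uminus \<epsilon>] by (simp add: bounded_linear_minus bounded_linear_ident)
    then have "smooth_on UNIV g" unfolding g_def by (intro smooth_on_add fl) auto
    then show "smooth_on UNIV \<sigma>" unfolding \<sigma>_def
      by (intro smooth_on_mult fl smooth_on_compose_real[OF _ _ smooth_on_inverse]) (use g in auto)
    show "(\<sigma> has_real_derivative \<sigma>' x) (at x)" for x
    proof -
      have "((\<lambda>x. f x / g x) has_real_derivative (f' x * g x - f x * (f' x - f' (\<epsilon> - x))) / (g x * g x)) (at x)"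
        using DERIV_divide[OF f dg, of x] g[of x] by simp
      also have "(f' x * g x - f x * (f' x - f' (\<epsilon> - x))) / (g x * g x) = \<sigma>' x"
        by (simp add: \<sigma>'_def g_def power2_eq_square algebra_simps)
      finally show ?thesis unfolding \<sigma>_def divide_inverse .
    qed
    show "0 \<le> \<sigma>' x" for x using f0 by (simp add: \<sigma>'_def)
    show "0 \<le> \<sigma> x" for x using f0 g[of x] by (simp add: \<sigma>_def)
    show "\<sigma> x \<le> 1" for x using f0[of "\<epsilon> - x"] g[of x] by (simp add: \<sigma>_def g_def field_simps)
    show "\<sigma> x = 0" if "x \<le> 0" for x using that by (simp add: \<sigma>_def f1)
    show "\<sigma> x = 1" if "\<epsilon> \<le> x" for x using that g[of x] by (simp add: \<sigma>_def g_def f1)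
  qed
qed

text \<open>Integrate a smooth step; a translation makes the linear end pass through the origin.\<close>

lemma regularized_positive_part_exists:
  fixes \<epsilon> :: real
  assumes "0 < \<epsilon>"
  shows "\<exists>\<gamma> \<gamma>' \<gamma>2 :: real \<Rightarrow> real. smooth_on UNIV \<gamma> \<and>
    (\<forall>x. (\<gamma> has_real_derivative \<gamma>' x) (at x)) \<and> (\<forall>x. (\<gamma>' has_real_derivative \<gamma>2 x) (at x)) \<and>
    (\<forall>x. 0 \<le> \<gamma>' x) \<and> (\<forall>x. \<gamma>' x \<le> 1) \<and> (\<forall>x. 0 \<le> \<gamma>2 x) \<and>
    (\<forall>x\<le>-\<epsilon>. \<gamma> x = 0) \<and> (\<forall>x\<ge>\<epsilon>. \<gamma> x = x)"
proof -
  obtain \<sigma> \<sigma>' where s': "smooth_on UNIV \<sigma>" "\<forall>x. (\<sigma> has_real_derivative \<sigma>' x) (at x)"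
    "\<forall>x. 0 \<le> \<sigma>' x" "\<forall>x. 0 \<le> \<sigma> x" "\<forall>x. \<sigma> x \<le> 1" "\<forall>x\<le>0. \<sigma> x = 0" "\<forall>x\<ge>\<epsilon>. \<sigma> x = 1"
    using smooth_step_exists[OF assms] by (elim exE conjE) (rule that)
  note s = s'[rule_format]
  have cont: "continuous_on A \<sigma>" for A
    using s(2) by (auto intro!: continuous_at_imp_continuous_on DERIV_isCont)
  \<comment> \<open>The lower limit lies where \<sigma> vanishes, so this is the antiderivative that
    is 0 on the negative half-line; it also makes every x >= 0 an interior point of
    \<open>{-1..x+1}\<close>, where the integral is differentiated.\<close>
  define g where "g x = integral {-1..x} \<sigma>" for x
  have g0: "g x = 0" if "x \<le> 0" for x
  proof -
    have "g x = integral {-1..x} (\<lambda>_. 0)" unfolding g_def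
      by (rule integral_cong) (use that s(6) in auto)
    then show ?thesis by simp
  qed
  have dg: "(g has_real_derivative \<sigma> x) (at x)" for x
  proof (cases "x < 0")
    case True
    have "((\<lambda>x. 0) has_real_derivative 0) (at x)" by simp
    then have "(g has_real_derivative 0) (at x)"
      by (rule has_field_derivative_transform_within_open[of _ _ _ "{..<0}"]) (use True g0 in auto)
    then show ?thesis using True s(6) by simp
  next
    case False
    have "(g has_real_derivative \<sigma> x) (at x within {-1..x+1})" unfolding g_def
      by (rule integral_has_real_derivative) (use False cont in auto)
    then show ?thesis using False by (simp add: at_within_Icc_at)
  qed
  \<comment> \<open>Beyond \<epsilon> the graph of \<open>g\<close> is the diagonal lowered by
    \<open>c\<close>. As \<sigma> takes values in [0, 1], \<open>c\<close> lies in [0, \<epsilon>];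
    hence x \<mapsto> g (c + x) is still 0 for x <= -\<epsilon> and is the identity for x >=
    \<epsilon>.\<close>
  define c where "c = \<epsilon> - g \<epsilon>"
  have lin: "g x = x - c" if "\<epsilon> \<le> x" for x
  proof -
    have "\<exists>k. \<forall>t\<in>{\<epsilon>..}. g t - t = k"
    proof (rule has_field_derivative_zero_constant)
      show "((\<lambda>t. g t - t) has_real_derivative 0) (at t within {\<epsilon>..})" if "t \<in> {\<epsilon>..}" for t
      proof -
        have "((\<lambda>t. g t - t) has_real_derivative \<sigma> t - 1) (at t within {\<epsilon>..})"
          by (intro derivative_intros has_field_derivative_at_within[OF dg])
        then show ?thesis using s(7) that by simp
      qed
    qed simp
    then have "g x - x = g \<epsilon> - \<epsilon>" using that by force
    then show ?thesis by (simp add: c_def)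
  qed
  have mono: "g x \<le> g y" if "x \<le> y" for x y
    by (rule DERIV_nonneg_imp_nondecreasing[OF that]) (use dg s(4) in blast)
  have c: "0 \<le> c" "c \<le> \<epsilon>"
  proof -
    have "g 0 - 0 \<ge> g \<epsilon> - \<epsilon>"
      by (rule DERIV_nonpos_imp_nonincreasing[of 0 \<epsilon> "\<lambda>t. g t - t"])
        (use assms in \<open>auto intro!: exI derivative_intros dg simp: s(5)\<close>)
    then show "0 \<le> c" by (simp add: c_def g0)
    show "c \<le> \<epsilon>" using mono[of 0 \<epsilon>] assms by (simp add: c_def g0)
  qed
  have smg: "smooth_on UNIV g"
  proof -
    have "Ck_on (Suc n) UNIV g" for n
      by (rule Ck_on_realI[OF open_UNIV dg]) (use s(1) in \<open>simp add: smooth_on_def\<close>)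
    then show ?thesis unfolding smooth_on_def using Ck_on_Suc_imp by blast
  qed
  show ?thesis
  proof (rule exI[of _ "\<lambda>x. g (c + x)"], rule exI[of _ "\<lambda>x. \<sigma> (c + x)"],
      rule exI[of _ "\<lambda>x. \<sigma>' (c + x)"], intro conjI allI impI)
    show "smooth_on UNIV (\<lambda>x. g (c + x))"
      using smooth_on_compose_affine[OF open_UNIV smg bounded_linear_ident] by simp
    show "((\<lambda>x. g (c + x)) has_real_derivative \<sigma> (c + x)) (at x)" for x
      using DERIV_shift[of g "\<sigma> (c + x)" x c] dg[of "c + x"] by (simp add: add.commute)
    show "((\<lambda>x. \<sigma> (c + x)) has_real_derivative \<sigma>' (c + x)) (at x)" for x
      using DERIV_shift[of \<sigma> "\<sigma>' (c + x)" x c] s(2)[of "c + x"] by (simp add: add.commute)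
    show "g (c + x) = 0" if "x \<le> - \<epsilon>" for x using that c by (intro g0) auto
    show "g (c + x) = x" if "\<epsilon> \<le> x" for x using that c by (subst lin) auto
  qed (use s in auto)
qed

section \<open>Hyperplanes and functionals\<close>

text \<open>When P is the kernel of l, the elements of V/P are the level sets of l. A vector of the
  quotient is thus named by a complex number, and P itself, its zero, is
  \<open>level l 0\<close>.\<close>

definition level :: "('v \<Rightarrow> complex) \<Rightarrow> complex \<Rightarrow> 'v set" where
  "level l z = {x. l x = z}"

lemma mem_level [simp]: "x \<in> level l z \<longleftrightarrow> l x = z"
  by (simp add: level_def)

section \<open>Quotients by a hyperplane, their duals and their metrics\<close>

locale complex_space = vector_space smul
  for smul :: "complex \<Rightarrow> 'v::ab_group_add \<Rightarrow> 'v"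
begin

abbreviation V where "V \<equiv> cvs_of smul"

lemma V_simps [simp]:
  "vcarrier V = UNIV" "vadd V = (+)" "vzero V = 0" "vsmul V = smul"
  by (simp_all add: cvs_of_def)

text \<open>The vector \<open>e\<close> witnesses that \<open>l\<close> is nonzero, and z \<mapsto>
  \<open>smul z e\<close> is a section of \<open>l\<close> that supplies a representative in every
  level set.\<close>

definition normalized_functional :: "('v \<Rightarrow> complex) \<Rightarrow> 'v \<Rightarrow> bool" where
  "normalized_functional l e \<longleftrightarrow> (\<forall>x y. l (x + y) = l x + l y) \<and> (\<forall>c x. l (smul c x) = c * l x) \<and> l e = 1"

lemma normalized_functionalD:
  assumes "normalized_functional l e"
  shows "l (x + y) = l x + l y" "l (smul c x) = c * l x" "l e = 1" "l 0 = 0" "l (x - y) = l x - l y"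
proof -
  show A: "l (x + y) = l x + l y" "l (smul c x) = c * l x" "l e = 1" for x y c
    using assms by (auto simp: normalized_functional_def)
  show "l 0 = 0" using A(2)[of 0 0] by simp
  show "l (x - y) = l x - l y" using A(1)[of "x - y" y] by simp
qed

context
  fixes l :: "'v \<Rightarrow> complex" and e :: 'v
  assumes l: "normalized_functional l e"
begin

lemma l_simps: "l (x + y) = l x + l y" "l (smul c x) = c * l x" "l e = 1" "l 0 = 0" "l (x - y) = l x - l y"
  using normalized_functionalD[OF l] .

lemma level_eq_iff: "level l z = level l w \<longleftrightarrow> z = w"
proof
  assume "level l z = level l w"
  then have "smul z e \<in> level l w" by (metis l_simps(2,3) mem_level mult.right_neutral)
  then show "z = w" by (simp add: l_simps)
qed simp

lemma coset_level: "coset V (level l 0) v = level l (l v)"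
proof -
  have "\<exists>p. x = v + p \<and> l p = 0" if "l x = l v" for x
    using that by (intro exI[of _ "x - v"]) (simp add: l_simps)
  then show ?thesis by (auto simp: coset_def l_simps)
qed

abbreviation Q where "Q \<equiv> quotient_space V (level l 0)"

lemma quotient_carrier: "vcarrier Q = range (level l)"
proof -
  have "level l z \<in> (\<lambda>v. level l (l v)) ` UNIV" for z
    by (rule image_eqI[of _ _ "smul z e"]) (simp_all add: l_simps)
  then show ?thesis by (auto simp: quotient_space_def coset_level)
qed

lemma quotient_zero: "vzero Q = level l 0"
  by (simp add: quotient_space_def)

lemma quotient_add: "vadd Q (level l z) (level l w) = level l (z + w)"
proof -
  have "\<exists>a b. x = a + b \<and> l a = z \<and> l b = w" if "l x = z + w" for x
    using that by (intro exI[of _ "smul z e"] exI[of _ "x - smul z e"]) (simp add: l_simps)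
  then show ?thesis by (auto simp: quotient_space_def l_simps)
qed

lemma quotient_smul: "vsmul Q c (level l z) = level l (c * z)"
proof -
  have "\<exists>a p. x = smul c a + p \<and> l a = z \<and> l p = 0" if "l x = c * z" for x
    using that by (intro exI[of _ "smul z e"] exI[of _ "x - smul c (smul z e)"]) (simp add: l_simps)
  then show ?thesis by (auto simp: quotient_space_def l_simps)
qed

lemma level_hyperplane: "level l 0 \<in> hyperplanes V"
  unfolding hyperplanes_def mem_Collect_eq
proof
  show "is_subspace (level l 0) V" by (auto simp: is_subspace_def l_simps)
  have "\<exists>u\<in>range (level l). u \<noteq> level l 0 \<and> (\<forall>v\<in>range (level l). \<exists>c. v = vsmul Q c u)"
    by (rule bexI[of _ "level l 1"]) (auto simp: quotient_smul level_eq_iff)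
  then show "one_dimensional Q"
    unfolding one_dimensional_def quotient_carrier quotient_zero .
qed

text \<open>In the coordinate given by \<open>l\<close> on V/P this is multiplication by
  \<open>t\<close>. It is restricted to the carrier because \<open>dual_space\<close> consists of
  extensional functions, so that equal functionals are equal as functions.\<close>

definition dual_vector :: "complex \<Rightarrow> 'v set \<Rightarrow> complex" where
  "dual_vector t = (\<lambda>A\<in>range (level l). t * (THE z. A = level l z))"

lemma dual_vector_level: "dual_vector t (level l z) = t * z"
proof -
  have "(THE w. level l z = level l w) = z" by (rule the_equality) (auto simp: level_eq_iff)
  then show ?thesis by (simp add: dual_vector_def)
qed

lemma dual_vector_carrier: "dual_vector t \<in> vcarrier (dual_space Q)"
  unfolding dual_space_def quotient_carrier
  by (auto simp: quotient_add quotient_smul dual_vector_level algebra_simps)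
    (simp add: dual_vector_def)

lemma dual_apply:
  assumes "\<xi> \<in> vcarrier (dual_space Q)"
  shows "\<xi> (level l z) = z * \<xi> (level l 1)"
proof -
  have "\<xi> (vsmul Q z (level l 1)) = z * \<xi> (level l 1)"
    using assms by (simp add: dual_space_def quotient_carrier)
  then show ?thesis by (simp add: quotient_smul)
qed

lemma dual_eq_dual_vector:
  assumes "\<xi> \<in> vcarrier (dual_space Q)"
  shows "\<xi> = dual_vector (\<xi> (level l 1))"
proof
  fix A
  show "\<xi> A = dual_vector (\<xi> (level l 1)) A"
  proof (cases "A \<in> range (level l)")
    case True
    then obtain z where "A = level l z" by auto
    then show ?thesis using dual_apply[OF assms, of z] by (simp add: dual_vector_level)
  next
    case False
    then show ?thesis using assms
      by (auto simp: dual_vector_def dual_space_def quotient_carrier extensional_def)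
  qed
qed

lemma dual_zero: "vzero (dual_space Q) = dual_vector 0"
  by (simp add: dual_space_def quotient_carrier dual_vector_def)

lemma dual_vector_eq_iff: "dual_vector t = dual_vector t' \<longleftrightarrow> t = t'"
  using dual_vector_level[of _ 1] by (metis mult.right_neutral)

text \<open>Moving z out of both slots of the hermitian form leaves z times its conjugate. A metric
  on a fiber of O(1) is thereby recorded by one positive number, its value at the generator
  \<open>level l 1\<close>.\<close>

lemma hermitian_metric_level:
  assumes "hermitian_metric Q q"
  shows "q (level l z) = (cmod z)\<^sup>2 * q (level l 1)" "0 < q (level l 1)"
proof -
  obtain g where g: "pos_def_hermitian_form Q g" and q: "\<And>v. v \<in> range (level l) \<Longrightarrow> complex_of_real (q v) = g v v"
    using assms unfolding hermitian_metric_def quotient_carrier by blast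
  let ?u = "level l 1"
  have s: "g (vsmul Q z ?u) w = z * g ?u w" if "w \<in> range (level l)" for w
    using g that unfolding pos_def_hermitian_form_def quotient_carrier by blast
  have c: "g w ?u = cnj (g ?u w)" if "w \<in> range (level l)" for w
    using g that unfolding pos_def_hermitian_form_def quotient_carrier by blast
  have z: "vsmul Q z ?u = level l z" by (simp add: quotient_smul)
  have "complex_of_real (q (level l z)) = z * g ?u (level l z)"
    using q[of "level l z"] s[of "level l z"] by (simp add: z)
  also have "g ?u (level l z) = cnj (g (level l z) ?u)" using c[of "level l z"] by simp
  also have "\<dots> = cnj z * cnj (g ?u ?u)" using s[of ?u] by (simp add: z)
  also have "g ?u ?u = complex_of_real (q ?u)" using q[of ?u] by simp
  finally have "complex_of_real (q (level l z)) = complex_of_real ((cmod z)\<^sup>2 * q ?u)"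
    by (simp flip: complex_norm_square mult.assoc)
  then show "q (level l z) = (cmod z)\<^sup>2 * q ?u" by (simp only: of_real_eq_iff)
  have "\<forall>u\<in>range (level l). u \<noteq> level l 0 \<longrightarrow> 0 < Re (g u u)"
    using g unfolding pos_def_hermitian_form_def quotient_carrier quotient_zero by (elim conjE)
  then have "0 < Re (g ?u ?u)" by (simp add: level_eq_iff)
  then show "0 < q ?u" by (simp flip: q)
qed

text \<open>On a line the quotient under the supremum is homogeneous of degree 0, hence constant off
  zero; the generator \<open>level l 1\<close> shows that the index set is nonempty.\<close>

lemma dual_norm:
  assumes "hermitian_metric Q q" "\<xi> \<in> vcarrier (dual_space Q)"
  shows "(SUP v\<in>vcarrier Q - {vzero Q}. (cmod (\<xi> v))\<^sup>2 / q v) = (cmod (\<xi> (level l 1)))\<^sup>2 / q (level l 1)"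
proof -
  have "(cmod (\<xi> v))\<^sup>2 / q v = (cmod (\<xi> (level l 1)))\<^sup>2 / q (level l 1)"
    if v: "v \<in> range (level l) - {level l 0}" for v
  proof -
    obtain z where z: "v = level l z" "z \<noteq> 0" using v by (auto simp: level_eq_iff)
    show ?thesis
      using z hermitian_metric_level(1)[OF assms(1), of z] dual_apply[OF assms(2), of z]
      by (simp add: norm_mult power_mult_distrib)
  qed
  moreover have "level l 1 \<in> range (level l) - {level l 0}" by (simp add: level_eq_iff)
  ultimately show ?thesis unfolding quotient_carrier quotient_zero
    by (smt (verit, best) SUP_cong cSUP_const empty_iff)
qed

lemma hermitian_metric_dual:
  assumes "0 < c"
  shows "hermitian_metric (dual_space Q) (\<lambda>\<xi>. (cmod (\<xi> (level l 1)))\<^sup>2 / c)"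
  unfolding hermitian_metric_def
proof (intro exI conjI ballI)
  let ?g = "\<lambda>\<xi> \<eta>. \<xi> (level l 1) * cnj (\<eta> (level l 1)) / complex_of_real c"
  have pos: "0 < Re (?g \<xi> \<xi>)" if "\<xi> \<in> vcarrier (dual_space Q)" "\<xi> \<noteq> vzero (dual_space Q)" for \<xi>
  proof -
    have "\<xi> (level l 1) \<noteq> 0"
      using dual_eq_dual_vector[OF that(1)] that(2) unfolding dual_zero by metis
    then show ?thesis using assms by (simp flip: complex_norm_square of_real_power of_real_divide)
  qed
  show "pos_def_hermitian_form (dual_space Q) ?g"
    unfolding pos_def_hermitian_form_def
    using pos by (auto simp: dual_space_def quotient_carrier add_divide_distrib algebra_simps)
  show "complex_of_real ((cmod (\<xi> (level l 1)))\<^sup>2 / c) = ?g \<xi> \<xi>" for \<xi>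
    by (simp flip: complex_norm_square)
qed

end

text \<open>As V/P is a line and \<open>e\<close> lies outside P, every vector is congruent modulo P
  to exactly one multiple of \<open>e\<close>. Its coefficient is the functional.\<close>

lemma hyperplane_functional:
  assumes "P \<in> hyperplanes V" "e \<notin> P"
  obtains l where "normalized_functional l e" "P = level l 0"
proof -
  have sub: "0 \<in> P" "\<And>u v. u \<in> P \<Longrightarrow> v \<in> P \<Longrightarrow> u + v \<in> P" "\<And>c u. u \<in> P \<Longrightarrow> smul c u \<in> P"
    using assms(1) by (auto simp: hyperplanes_def is_subspace_def)
  have neg: "u - v \<in> P" if "u \<in> P" "v \<in> P" for u v
    using sub(2)[OF that(1) sub(3)[OF that(2), of "-1"]] by simp
  obtain u0 where u0: "\<And>v. \<exists>c. coset V P v = vsmul (quotient_space V P) c (coset V P u0)"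
    using assms(1) unfolding hyperplanes_def one_dimensional_def
    by (auto simp: quotient_space_def)
  have u1: "\<exists>c. v - smul c u0 \<in> P" for v
  proof -
    obtain c where "coset V P v = vsmul (quotient_space V P) c (coset V P u0)" using u0 by blast
    moreover have "v \<in> coset V P v" using sub(1) by (auto simp: coset_def intro: exI[of _ 0])
    ultimately obtain p p' where "v = smul c (u0 + p) + p'" "p \<in> P" "p' \<in> P"
      by (auto simp: quotient_space_def coset_def)
    then show ?thesis using sub by (intro exI[of _ c]) (simp add: scale_right_distrib)
  qed
  \<comment> \<open>Change of generator from \<open>u0\<close> to \<open>e\<close>: the factor d is
    nonzero since \<open>e\<close> is not in P, so coefficients relative to \<open>e\<close> arise
    from division by d.\<close>
  obtain d where d: "e - smul d u0 \<in> P" using u1 by blast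
  have d0: "d \<noteq> 0" using d assms(2) by auto
  have ex: "\<exists>c. v - smul c e \<in> P" for v
  proof -
    obtain c where c: "v - smul c u0 \<in> P" using u1 by blast
    have "v - smul (c / d) e = (v - smul c u0) - smul (c / d) (e - smul d u0)"
      using d0 by (simp add: scale_right_diff_distrib)
    then show ?thesis using neg[OF c sub(3)[OF d]] by metis
  qed
  define l where "l v = (SOME c. v - smul c e \<in> P)" for v
  have l: "v - smul (l v) e \<in> P" for v
    unfolding l_def by (rule someI_ex[OF ex])
  have uniq: "l v = c" if "v - smul c e \<in> P" for v c
  proof (rule ccontr)
    assume ne: "l v \<noteq> c"
    have "smul (l v - c) e = (v - smul c e) - (v - smul (l v) e)"
      by (simp add: scale_left_diff_distrib)
    then have "smul (l v - c) e \<in> P" using neg[OF that l[of v]] by simp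
    then have "smul (1 / (l v - c)) (smul (l v - c) e) \<in> P" by (rule sub(3))
    then show False using ne assms(2) by simp
  qed
  show thesis
  proof (rule that[of l])
    show "normalized_functional l e"
      unfolding normalized_functional_def
    proof (intro conjI allI)
      show "l (x + y) = l x + l y" for x y
        using sub(2)[OF l[of x] l[of y]] by (intro uniq) (simp add: scale_left_distrib algebra_simps)
      show "l (smul c x) = c * l x" for c x
        using sub(3)[OF l[of x], of c] by (intro uniq) (simp add: scale_right_diff_distrib)
      show "l e = 1" using sub(1) by (intro uniq) simp
    qed
    show "P = level l 0"
    proof (rule set_eqI)
      show "x \<in> P \<longleftrightarrow> x \<in> level l 0" for x
        using l[of x] uniq[of x 0] by auto
    qed
  qed
qed

text \<open>The functional with value 1 on the frame vector \<open>None\<close> of \<open>T\<close>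
  and value \<open>a $ j\<close> on \<open>Some j\<close>; its kernel is the hyperplane with affine
  coordinates \<open>a\<close>, so this inverts \<open>affine_coord\<close>.\<close>

definition chart_functional :: "('v \<Rightarrow> complex ^ ('d::finite option)) \<Rightarrow> complex ^ 'd \<Rightarrow> 'v \<Rightarrow> complex" where
  "chart_functional T a v = T v $ None + (\<Sum>j\<in>UNIV. a $ j * T v $ Some j)"

context
  fixes T :: "'v \<Rightarrow> complex ^ ('d::finite option)"
  assumes T: "linear_iso V T"
begin

abbreviation (input) fr where "fr \<equiv> std_frame V T"

lemma T_simps: "bij T" "T (u + v) = T u + T v" "T (smul c v) = c *s T v"
  using T by (auto simp: linear_iso_def)

lemma T_frame: "T (fr i) = axis i 1"
  using bij_betw_inv_into_right[OF T_simps(1), of "axis i 1"] by (simp add: std_frame_def)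

lemma chart_functional: "normalized_functional (chart_functional T a) (fr None)"
  unfolding normalized_functional_def chart_functional_def T_simps T_frame
  by (auto simp: algebra_simps sum.distrib sum_distrib_left axis_def)

lemma chart_functional_frame: "chart_functional T a (fr (Some j)) = a $ j"
  unfolding chart_functional_def T_frame
  by (simp add: axis_def if_distrib cong: if_cong)

lemma sum_option: "(\<Sum>i\<in>UNIV. f i) = f None + (\<Sum>j\<in>UNIV. f (Some j))"
  for f :: "'d option \<Rightarrow> 'a::comm_monoid_add"
  by (simp add: UNIV_option_conv sum.reindex)

lemma functional_expansion:
  assumes "normalized_functional l e"
  shows "l v = (\<Sum>i\<in>UNIV. T v $ i * l (fr i))"
proof -
  note l = normalized_functionalD[OF assms]
  have lsum: "l (\<Sum>i\<in>I. f i) = (\<Sum>i\<in>I. l (f i))" for f and I :: "'d option set"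
    by (induction I rule: infinite_finite_induct) (simp_all add: l)
  have Tsum: "T (\<Sum>i\<in>I. f i) = (\<Sum>i\<in>I. T (f i))" for f and I :: "'d option set"
    using T_simps(3)[of 0 0] by (induction I rule: infinite_finite_induct) (simp_all add: T_simps)
  have "T (\<Sum>i\<in>UNIV. smul (T v $ i) (fr i)) = T v"
    unfolding Tsum T_simps T_frame by (simp add: vec_eq_iff axis_def if_distrib cong: if_cong)
  then have "v = (\<Sum>i\<in>UNIV. smul (T v $ i) (fr i))"
    using T_simps(1) by (metis bij_def injD)
  then have "l v = l (\<Sum>i\<in>UNIV. smul (T v $ i) (fr i))" by simp
  then show ?thesis by (simp add: lsum l)
qed

lemma functional_eq_chart_functional:
  assumes "normalized_functional l (fr None)"
  shows "l = chart_functional T (\<chi> j. l (fr (Some j)))"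
proof
  show "l v = chart_functional T (\<chi> j. l (fr (Some j))) v" for v
    unfolding functional_expansion[OF assms, of v] chart_functional_def
    by (simp add: sum_option normalized_functionalD[OF assms] mult.commute)
qed

abbreviation (input) cf where "cf \<equiv> chart_functional T"

lemma affine_coord_level: "affine_coord V fr (level (cf a) 0) = a"
proof -
  have "(THE z. fr (Some j) \<in> coset V (level (cf a) 0) (smul z (fr None))) = a $ j" for j
    by (rule the_equality)
      (auto simp: coset_level[OF chart_functional] chart_functional_frame normalized_functionalD[OF chart_functional])
  then show ?thesis by (simp add: affine_coord_def vec_eq_iff)
qed

lemma frame_notin_level: "fr None \<notin> level (cf a) 0"
  by (simp add: normalized_functionalD[OF chart_functional])

lemma hyperplane_chart:
  assumes "P \<in> hyperplanes V" "fr None \<notin> P"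
  shows "P = level (cf (affine_coord V fr P)) 0"
proof -
  obtain l where "normalized_functional l (fr None)" "P = level l 0"
    using hyperplane_functional[OF assms] .
  then show ?thesis using functional_eq_chart_functional affine_coord_level by metis
qed

lemma quotient_triv_level: "quotient_triv V fr (level (cf a) z) = (\<chi> _. z)"
proof -
  have "(THE w. smul w (fr None) \<in> level (cf a) z) = z"
    by (rule the_equality) (auto simp: normalized_functionalD[OF chart_functional])
  then show ?thesis by (simp add: quotient_triv_def)
qed

text \<open>The trivialization sends the class of \<open>fr None\<close> to 1, and that class is the
  level set of value 1. Metrics are therefore evaluated at \<open>level (cf a) 1\<close> in this
  chart.\<close>

lemma std_frame_quotient:
  "std_frame (quotient_space V (level (cf a) 0)) (quotient_triv V fr) i = level (cf a) 1"
  unfolding std_frame_def[of "quotient_space V (level (cf a) 0)"] quotient_carrier[OF chart_functional]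
proof (rule inv_into_f_eq)
  show "inj_on (quotient_triv V fr) (range (level (cf a)))"
    by (auto simp: inj_on_def quotient_triv_level vec_eq_iff)
  show "quotient_triv V fr (level (cf a) 1) = axis i 1"
    unfolding quotient_triv_level by (simp add: vec_eq_iff axis_def)
qed simp

end

end

section \<open>Charts of O(1)\<close>

lemma strongly_psh_on_cong:
  fixes u v :: "complex ^ 'n::finite \<Rightarrow> real"
  assumes "open S" "\<And>x. x \<in> S \<Longrightarrow> u x = v x" "strongly_psh_on S u"
  shows "strongly_psh_on S v"
proof -
  have su: "smooth_on S u" using assms(3) by (simp add: strongly_psh_on_def)
  have sv: "smooth_on S v" using smooth_on_cong[OF su assms(1,2)] .
  have D: "frechet_derivative u (at x) = frechet_derivative v (at x)" if "x \<in> S" for x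
    by (rule frechet_derivative_at)
      (rule has_derivative_transform_within_open[OF smooth_on_derivatives(1)[OF su that] assms(1) that assms(2)])
  have "hess u z w' w = hess v z w' w" if "z \<in> S" for z w' w
  proof -
    have "((\<lambda>x. frechet_derivative v (at x) w) has_derivative (\<lambda>v. hess u z v w)) (at z)"
      by (rule has_derivative_transform_within_open[OF smooth_on_derivatives(2)[OF su that] assms(1) that])
        (simp add: D)
    from has_derivative_unique[OF this smooth_on_derivatives(2)[OF sv that]]
    show ?thesis by (simp add: fun_eq_iff)
  qed
  then show ?thesis using assms(3) sv unfolding strongly_psh_on_iff[OF assms(1)] by simp
qed

text \<open>Charts of a total space enter the curvature conditions only through images and
  \<open>inv_into\<close>. An explicit two-sided inverse \<Theta> computes both; \<open>Z\<close> is
  meant to be the zero section and \<open>N\<close> its equation in coordinates.\<close>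

lemma chart_image:
  assumes "\<And>y. y \<in> Y \<Longrightarrow> \<Theta> y \<in> D \<and> \<Psi> (\<Theta> y) = y" "\<And>x. x \<in> D \<Longrightarrow> \<Psi> x \<in> Y \<and> \<Theta> (\<Psi> x) = x"
    and "\<And>y. y \<in> Y \<Longrightarrow> \<Theta> y \<in> Z \<longleftrightarrow> N y"
  shows "\<Psi> ` D = Y" "\<Psi> ` (D - Z) = {y \<in> Y. \<not> N y}" "\<And>y. y \<in> Y \<Longrightarrow> inv_into D \<Psi> y = \<Theta> y"
proof -
  show "\<Psi> ` D = Y" using assms(1,2) by force
  show "\<Psi> ` (D - Z) = {y \<in> Y. \<not> N y}"
  proof (intro equalityI subsetI)
    fix y assume "y \<in> \<Psi> ` (D - Z)"
    then show "y \<in> {y \<in> Y. \<not> N y}" using assms(2,3) by force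
  next
    fix y assume "y \<in> {y \<in> Y. \<not> N y}"
    then show "y \<in> \<Psi> ` (D - Z)" using assms(1,3) by (intro image_eqI[of _ _ "\<Theta> y"]) auto
  qed
  have inj: "inj_on \<Psi> D" using assms(2) by (metis inj_onI)
  show "inv_into D \<Psi> y = \<Theta> y" if "y \<in> Y" for y
    using inv_into_f_f[OF inj, of "\<Theta> y"] assms(1)[OF that] by simp
qed

lemma hermitian_metric_cong:
  assumes "hermitian_metric W q" "\<And>v. v \<in> vcarrier W \<Longrightarrow> q v = q' v"
  shows "hermitian_metric W q'"
  using assms(1) unfolding hermitian_metric_def by (simp add: assms(2) cong: ball_cong)

lemma hermitian_metric_scale:
  assumes "hermitian_metric W q" "0 < c"
  shows "hermitian_metric W (\<lambda>v. q v * c)"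
proof -
  obtain g where g: "pos_def_hermitian_form W g" and q: "\<forall>v\<in>vcarrier W. complex_of_real (q v) = g v v"
    using assms(1) unfolding hermitian_metric_def by blast
  have "pos_def_hermitian_form W (\<lambda>u v. g u v * complex_of_real c)"
    unfolding pos_def_hermitian_form_def
  proof (intro conjI ballI allI impI)
    fix u v w a assume c: "u \<in> vcarrier W" "v \<in> vcarrier W" "w \<in> vcarrier W"
    have "g (vadd W u v) w = g u w + g v w" using g c unfolding pos_def_hermitian_form_def by blast
    then show "g (vadd W u v) w * complex_of_real c = g u w * complex_of_real c + g v w * complex_of_real c"
      by (simp add: distrib_right)
    have "g (vsmul W a u) w = a * g u w" using g c unfolding pos_def_hermitian_form_def by blast
    then show "g (vsmul W a u) w * complex_of_real c = a * (g u w * complex_of_real c)" by simp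
    have "g w u = cnj (g u w)" using g c unfolding pos_def_hermitian_form_def by blast
    then show "g w u * complex_of_real c = cnj (g u w * complex_of_real c)" by simp
  next
    fix u assume "u \<in> vcarrier W" "u \<noteq> vzero W"
    then have "0 < Re (g u u)" using g unfolding pos_def_hermitian_form_def by blast
    then show "0 < Re (g u u * complex_of_real c)" using assms(2) by simp
  qed
  then show ?thesis unfolding hermitian_metric_def using q by (intro exI conjI) auto
qed

context complex_space
begin

text \<open>For P = V all cosets coincide with the zero of the quotient, which leaves no
  generator.\<close>

lemma hyperplane_proper:
  assumes "P \<in> hyperplanes V"
  obtains e where "e \<notin> P"
proof -
  have False if "P = UNIV"
  proof -
    have "coset V P v = UNIV" for v
      using that by (auto simp: coset_def intro: exI[of _ "_ - v"])
    then show False using assms that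
      by (auto simp: hyperplanes_def one_dimensional_def quotient_space_def)
  qed
  then show thesis using that by blast
qed

lemma hyperplane_cases:
  assumes "P \<in> hyperplanes V"
  obtains l e where "normalized_functional l e" "P = level l 0"
proof -
  obtain e where "e \<notin> P" using hyperplane_proper[OF assms] .
  then show thesis using hyperplane_functional[OF assms] that by metis
qed

text \<open>A permuted frame is the standard frame of permuted coordinates. Hence the permutations
  in the atlas of \<open>O1_bundle\<close> can be absorbed into \<open>T\<close>, and any frame
  vector can be moved to position \<open>None\<close>.\<close>

lemma linear_iso_permute:
  fixes T :: "'v \<Rightarrow> complex ^ ('d::finite option)"
  assumes T: "linear_iso V T" and p: "bij p"
  shows "linear_iso V (\<lambda>v. \<chi> a. T v $ p a)"
    and "std_frame V (\<lambda>v. \<chi> a. T v $ p a) a = std_frame V T (p a)"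
proof -
  let ?P = "\<lambda>x :: complex ^ ('d option). \<chi> a. x $ p a"
  have "bij ?P"
    by (rule o_bij[of "\<lambda>x. \<chi> a. x $ inv p a"]) (use p in \<open>auto simp: fun_eq_iff vec_eq_iff bij_is_inj bij_is_surj surj_f_inv_f\<close>)
  then have b: "bij (\<lambda>v. ?P (T v))"
    using bij_comp[OF T_simps(1)[OF T]] by (simp add: o_def)
  then show "linear_iso V (\<lambda>v. \<chi> a. T v $ p a)"
    using T by (simp add: linear_iso_def vec_eq_iff)
  have "?P (T (std_frame V T (p a))) = axis a 1"
    unfolding T_frame[OF T] using p by (auto simp: axis_def vec_eq_iff bij_def inj_eq)
  then show "std_frame V (\<lambda>v. \<chi> a. T v $ p a) a = std_frame V T (p a)"
    unfolding std_frame_def[of V "\<lambda>v. \<chi> a. T v $ p a" a] using b by (auto intro!: inv_into_f_eq simp: bij_def)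
qed

text \<open>A hyperplane together with the frame vector of O(1) over it; minus the logarithm of a
  metric at this pair is the local weight.\<close>

definition chart_point :: "('v \<Rightarrow> complex ^ ('d::finite option)) \<Rightarrow> complex ^ 'd \<Rightarrow> 'v set \<times> 'v set" where
  "chart_point T a = (level (chart_functional T a) 0, level (chart_functional T a) 1)"

text \<open>A single chart of the dual bundle has all of complex space as its image, and there the
  dual metric is |t|^2 divided by \<kappa> of the frame vector, a \<open>weighted_norm\<close>. Then
  \<open>strongly_psh_on_weightD\<close> extracts the weight.\<close>

lemma strongly_psh_on_O1_space:
  fixes T :: "'v \<Rightarrow> complex ^ ('d::finite option)" and \<kappa> :: "'v set \<times> 'v set \<Rightarrow> real"
  assumes T: "linear_iso V T"
    and pos: "positively_curved (O1_space V :: ('v set, 'v set, 'd, 1) vbundle) \<kappa>"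
  shows "strongly_psh_on UNIV (\<lambda>a. - ln (\<kappa> (chart_point T a)))"
proof -
  let ?O = "O1_space V :: ('v set, 'v set, 'd, 1) vbundle"
  let ?fr = "std_frame V T"
  let ?U = "{P \<in> hyperplanes V. ?fr None \<notin> P}"
  let ?\<tau> = "\<lambda>P \<xi>. \<chi> a::1. \<xi> (std_frame (quotient_space V P) (quotient_triv V ?fr) a)"
  let ?\<Psi> = "total_coord (affine_coord V ?fr) ?\<tau> :: 'v set \<times> ('v set \<Rightarrow> complex) \<Rightarrow> complex ^ ('d + 1)"
  let ?D = "total_dom (dual_bundle ?O) ?U"
  let ?l = "\<lambda>y :: complex ^ ('d + 1). chart_functional T (base_part y)"
  let ?\<Theta> = "\<lambda>y. (level (?l y) 0, dual_vector (?l y) (y $ Inr 1))"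
  let ?\<phi> = "\<lambda>a. - ln (\<kappa> (chart_point T a))"
  note cf = chart_functional[OF T]
  have atl: "(?U, affine_coord V ?fr, ?\<tau>) \<in> atlas (dual_bundle ?O)"
    unfolding dual_bundle_def O1_space_def using T by (force simp: image_iff)
  have \<Psi>: "?\<Psi> (level (chart_functional T a) 0, \<xi>) = vec_append a (\<chi> _. \<xi> (level (chart_functional T a) 1))" for a \<xi>
    unfolding total_coord_def vec_append_def
    by (simp add: affine_coord_level[OF T] std_frame_quotient[OF T])
  have 1: "?\<Theta> y \<in> ?D \<and> ?\<Psi> (?\<Theta> y) = y" for y
  proof
    show "?\<Theta> y \<in> ?D"
      using level_hyperplane[OF cf] frame_notin_level[OF T] dual_vector_carrier[OF cf]
      by (simp add: total_dom_def dual_bundle_def O1_space_def)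
    have "(\<chi> _. y $ Inr 1) = (fiber_part y :: complex ^ 1)" by (simp add: vec_eq_iff)
    then show "?\<Psi> (?\<Theta> y) = y"
      unfolding \<Psi> dual_vector_level[OF cf] by simp
  qed
  have 2: "?\<Psi> x \<in> UNIV \<and> ?\<Theta> (?\<Psi> x) = x" if "x \<in> ?D" for x
  proof -
    obtain P \<xi> where x: "x = (P, \<xi>)" "P \<in> hyperplanes V" "?fr None \<notin> P" "\<xi> \<in> vcarrier (dual_space (quotient_space V P))"
      using \<open>x \<in> ?D\<close> by (auto simp: total_dom_def dual_bundle_def O1_space_def)
    obtain a where a: "P = level (chart_functional T a) 0" using hyperplane_chart[OF T x(2,3)] by blast
    show ?thesis using dual_eq_dual_vector[OF cf x(4)[unfolded a]] unfolding x(1) a \<Psi> by simp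
  qed
  have 3: "?\<Theta> y \<in> zero_section (dual_bundle ?O) \<longleftrightarrow> y $ Inr 1 = 0" for y
    using level_hyperplane[OF cf]
    by (auto simp: zero_section_def dual_bundle_def O1_space_def dual_zero[OF cf] dual_vector_eq_iff[OF cf])
  note im = chart_image[of UNIV ?\<Theta> ?D ?\<Psi> "zero_section (dual_bundle ?O)" "\<lambda>y. y $ Inr 1 = 0", OF 1 2 3, simplified]
  have hm: "hermitian_metric (quotient_space V P) (\<lambda>v. \<kappa> (P, v))" if "P \<in> hyperplanes V" for P
    using pos that by (simp add: positively_curved_def bundle_metric_def O1_space_def)
  have val: "(dual_metric ?O \<kappa> \<circ> inv_into ?D ?\<Psi>) y = weighted_norm ?\<phi> y" for y
  proof -
    note h = hm[OF level_hyperplane[OF cf]]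
    have "(dual_metric ?O \<kappa> \<circ> inv_into ?D ?\<Psi>) y = dual_metric ?O \<kappa> (?\<Theta> y)"
      by (simp add: im(3))
    also have "\<dots> = (cmod (y $ Inr 1))\<^sup>2 / \<kappa> (chart_point T (base_part y))"
      using dual_norm[OF cf h dual_vector_carrier[OF cf]]
      by (simp add: dual_metric_def O1_space_def chart_point_def dual_vector_level[OF cf])
    also have "\<dots> = weighted_norm ?\<phi> y"
      using hermitian_metric_level(2)[OF cf h]
      by (simp add: weighted_norm_def chart_point_def exp_minus divide_inverse)
    finally show ?thesis .
  qed
  have eq: "dual_metric ?O \<kappa> \<circ> inv_into ?D ?\<Psi> = weighted_norm ?\<phi>" using val by (rule ext)
  have "smooth_on UNIV (weighted_norm ?\<phi>)"
    using pos atl im(1) unfolding positively_curved_def negatively_curved_def smooth_on_total_def eq[symmetric]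
    by fastforce
  moreover have "strongly_psh_on {y. y $ Inr 1 \<noteq> 0} (weighted_norm ?\<phi>)"
    using pos atl im(2) unfolding positively_curved_def negatively_curved_def strongly_psh_off_zero_def eq[symmetric]
    by fastforce
  ultimately show ?thesis by (rule strongly_psh_on_weightD)
qed

text \<open>The passage back from weights to metrics, now over the product of B and the projective
  space. Up to the choice of \<open>T\<close> all charts have the same shape, so plurisubharmonicity
  of the weight for every \<open>T\<close> settles the whole atlas.\<close>

lemma positively_curved_O1_bundle:
  fixes k :: "((complex ^ 'm::finite) \<times> 'v set) \<times> 'v set \<Rightarrow> real"
  assumes B: "open B"
    and hm: "\<And>s P. s \<in> B \<Longrightarrow> P \<in> hyperplanes V \<Longrightarrow> hermitian_metric (quotient_space V P) (\<lambda>v. k ((s, P), v))"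
    and psh: "\<And>T :: 'v \<Rightarrow> complex ^ ('d::finite option). linear_iso V T \<Longrightarrow>
      strongly_psh_on {x. base_part x \<in> B}
        (\<lambda>x. - ln (k ((base_part x, fst (chart_point T (fiber_part x))), snd (chart_point T (fiber_part x)))))"
  shows "positively_curved (O1_bundle (trivial_bundle B V :: (complex ^ 'm, 'v, 'm, 'd option) vbundle)) k"
proof -
  let ?O = "O1_bundle (trivial_bundle B V :: (complex ^ 'm, 'v, 'm, 'd option) vbundle)"
  have base: "base ?O = B \<times> hyperplanes V" and fiber: "fiber ?O = (\<lambda>(s, P). quotient_space V P)"
    by (auto simp: O1_bundle_def trivial_bundle_def)
  have dual: "dual_metric ?O k ((s, level l 0), \<xi>) = (cmod (\<xi> (level l 1)))\<^sup>2 / k ((s, level l 0), level l 1)"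
    if "s \<in> B" "normalized_functional l e" "\<xi> \<in> vcarrier (dual_space (quotient_space V (level l 0)))" for s l e \<xi>
    using dual_norm[OF that(2) hm[OF that(1) level_hyperplane[OF that(2)]] that(3)]
    by (simp add: dual_metric_def fiber)
  have chart: "smooth_on (total_coord \<phi> \<tau> ` total_dom (dual_bundle ?O) U)
        (dual_metric ?O k \<circ> inv_into (total_dom (dual_bundle ?O) U) (total_coord \<phi> \<tau>)) \<and>
      strongly_psh_on (total_coord \<phi> \<tau> ` (total_dom (dual_bundle ?O) U - zero_section (dual_bundle ?O)))
        (dual_metric ?O k \<circ> inv_into (total_dom (dual_bundle ?O) U) (total_coord \<phi> \<tau>))"
    if atl: "(U, \<phi>, \<tau>) \<in> atlas (dual_bundle ?O)" for U \<phi> \<tau>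
  proof -
    obtain T0 :: "'v \<Rightarrow> complex ^ ('d option)" and p where T0: "linear_iso V T0" "bij p"
      and U0: "U = {(s, P). s \<in> B \<and> P \<in> hyperplanes V \<and> std_frame V T0 (p None) \<notin> P}"
      and \<phi>0: "\<phi> = (\<lambda>(s, P). \<chi> i. case i of Inl b \<Rightarrow> s $ b
           | Inr j \<Rightarrow> affine_coord V (\<lambda>a. std_frame V T0 (p a)) P $ j)"
      and \<tau>0: "\<tau> = (\<lambda>x \<xi>. \<chi> a. \<xi> (std_frame (fiber ?O x)
           ((\<lambda>(s, P). quotient_triv V (\<lambda>a. std_frame V T0 (p a))) x) a))"
      using atl unfolding dual_bundle_def O1_bundle_def trivial_bundle_def by auto
    \<comment> \<open>The permutation is absorbed here: from now on the chart is the one of the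
      unpermuted frame of \<open>T\<close>.\<close>
    define T where "T = (\<lambda>v. \<chi> a. T0 v $ p a)"
    have T: "linear_iso V T" unfolding T_def by (rule linear_iso_permute[OF T0])
    have fr: "(\<lambda>a. std_frame V T0 (p a)) = std_frame V T" "std_frame V T0 (p None) = std_frame V T None"
      unfolding T_def by (simp_all add: fun_eq_iff linear_iso_permute(2)[OF T0])
    note cf = chart_functional[OF T]
    let ?fr = "std_frame V T"
    let ?\<Psi> = "total_coord \<phi> \<tau>"
    let ?D = "total_dom (dual_bundle ?O) U"
    let ?Y = "{y :: complex ^ (('m + 'd) + 1). base_part y \<in> {x. base_part x \<in> B}}"
    let ?l = "\<lambda>y :: complex ^ (('m + 'd) + 1). chart_functional T (fiber_part (base_part y))"
    let ?\<Theta> = "\<lambda>y. ((base_part (base_part y), level (?l y) 0), dual_vector (?l y) (y $ Inr 1))"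
    let ?\<phi> = "\<lambda>x :: complex ^ ('m + 'd). - ln (k ((base_part x, fst (chart_point T (fiber_part x))), snd (chart_point T (fiber_part x))))"
    have Bo: "open {x :: complex ^ ('m + 'd). base_part x \<in> B}" by (rule open_vimage_base_part[OF B])
    have D: "?D = {((s, P), \<xi>). s \<in> B \<and> P \<in> hyperplanes V \<and> ?fr None \<notin> P \<and>
        \<xi> \<in> vcarrier (dual_space (quotient_space V P))}"
      unfolding total_dom_def U0 fr by (auto simp: dual_bundle_def fiber)
    have \<Psi>: "?\<Psi> ((s, level (chart_functional T a) 0), \<xi>) =
        vec_append (vec_append s a) (\<chi> _. \<xi> (level (chart_functional T a) 1))" for s a \<xi>
      unfolding total_coord_def vec_append_def \<phi>0 \<tau>0 fiber fr
      by (simp add: affine_coord_level[OF T] std_frame_quotient[OF T])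
    have 1: "?\<Theta> y \<in> ?D \<and> ?\<Psi> (?\<Theta> y) = y" if "y \<in> ?Y" for y
    proof
      show "?\<Theta> y \<in> ?D" unfolding D using that
        level_hyperplane[OF cf] frame_notin_level[OF T] dual_vector_carrier[OF cf] by simp
      have "(\<chi> _. y $ Inr 1) = (fiber_part y :: complex ^ 1)" by (simp add: vec_eq_iff)
      then show "?\<Psi> (?\<Theta> y) = y" unfolding \<Psi> dual_vector_level[OF cf] by simp
    qed
    have 2: "?\<Psi> x \<in> ?Y \<and> ?\<Theta> (?\<Psi> x) = x" if "x \<in> ?D" for x
    proof -
      obtain s P \<xi> where x: "x = ((s, P), \<xi>)" "P \<in> hyperplanes V" "?fr None \<notin> P" "s \<in> B"
        "\<xi> \<in> vcarrier (dual_space (quotient_space V P))"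
        using \<open>x \<in> ?D\<close> unfolding D by auto
      obtain a where a: "P = level (chart_functional T a) 0" using hyperplane_chart[OF T x(2,3)] by blast
      show ?thesis using x(4) dual_eq_dual_vector[OF cf x(5)[unfolded a]] unfolding x(1) a \<Psi> by simp
    qed
    have 3: "?\<Theta> y \<in> zero_section (dual_bundle ?O) \<longleftrightarrow> y $ Inr 1 = 0" if "y \<in> ?Y" for y
      using level_hyperplane[OF cf] that
      by (auto simp: zero_section_def dual_bundle_def fiber base dual_zero[OF cf] dual_vector_eq_iff[OF cf])
    note im = chart_image[of ?Y ?\<Theta> ?D ?\<Psi> "zero_section (dual_bundle ?O)" "\<lambda>y. y $ Inr 1 = 0", OF 1 2 3]
    have im1: "?\<Psi> ` ?D = ?Y" by (rule im(1))
    have im2: "?\<Psi> ` (?D - zero_section (dual_bundle ?O)) = {y \<in> ?Y. \<not> y $ Inr 1 = 0}" by (rule im(2))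
    have im3: "inv_into ?D ?\<Psi> y = ?\<Theta> y" if "y \<in> ?Y" for y using that by (intro im(3))
    have val: "weighted_norm ?\<phi> y = (dual_metric ?O k \<circ> inv_into ?D ?\<Psi>) y" if y: "y \<in> ?Y" for y
    proof -
      have s: "base_part (base_part y) \<in> B" using y by simp
      have "(dual_metric ?O k \<circ> inv_into ?D ?\<Psi>) y = dual_metric ?O k (?\<Theta> y)"
        using im3[OF y] by simp
      also have "\<dots> = (cmod (y $ Inr 1))\<^sup>2 / k ((base_part (base_part y), level (?l y) 0), level (?l y) 1)"
        using dual[OF s cf dual_vector_carrier[OF cf]] by (simp add: dual_vector_level[OF cf])
      also have "\<dots> = weighted_norm ?\<phi> y"
        using hermitian_metric_level(2)[OF cf hm[OF s level_hyperplane[OF cf]]]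
        by (simp add: weighted_norm_def chart_point_def exp_minus divide_inverse)
      finally show ?thesis by simp
    qed
    have sm: "smooth_on {x. base_part x \<in> B} ?\<phi>" using psh[OF T] by (simp add: strongly_psh_on_def)
    show ?thesis unfolding im1 im2
    proof
      show "smooth_on ?Y (dual_metric ?O k \<circ> inv_into ?D ?\<Psi>)"
        by (rule smooth_on_cong[OF smooth_on_weighted_norm[OF Bo sm] open_vimage_base_part[OF Bo] val])
      have "strongly_psh_on {y. base_part y \<in> {x. base_part x \<in> B} \<and> y $ Inr 1 \<noteq> 0}
          (dual_metric ?O k \<circ> inv_into ?D ?\<Psi>)"
        by (rule strongly_psh_on_cong[OF open_off_zero[OF Bo] _ strongly_psh_on_weighted_norm[OF Bo psh[OF T]]])
          (rule val, simp)
      then show "strongly_psh_on {y \<in> ?Y. \<not> y $ Inr 1 = 0} (dual_metric ?O k \<circ> inv_into ?D ?\<Psi>)"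
        by simp
    qed
  qed
  have dm: "hermitian_metric (dual_space (quotient_space V P)) (\<lambda>\<xi>. dual_metric ?O k ((s, P), \<xi>))"
    if sP: "s \<in> B" "P \<in> hyperplanes V" for s P
  proof -
    obtain l e where l: "normalized_functional l e" "P = level l 0" using hyperplane_cases[OF sP(2)] .
    have c: "0 < k ((s, P), level l 1)"
      using hermitian_metric_level(2)[OF l(1), of "\<lambda>v. k ((s, P), v)"] hm[OF sP] l(2) by simp
    show ?thesis
      using hermitian_metric_cong[OF hermitian_metric_dual[OF l(1) c]] dual[OF sP(1) l(1)] l(2) by simp
  qed
  have dbase: "base (dual_bundle ?O) = B \<times> hyperplanes V"
    and dfiber: "fiber (dual_bundle ?O) = (\<lambda>(s, P). dual_space (quotient_space V P))"
    by (auto simp: dual_bundle_def base fiber)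
  show ?thesis
    unfolding positively_curved_def negatively_curved_def bundle_metric_def smooth_on_total_def
      strongly_psh_off_zero_def base fiber dbase dfiber
    using chart dm hm by auto
qed

end

section \<open>Choice of the constants\<close>

lemma strongly_psh_on_subset: "strongly_psh_on S u \<Longrightarrow> S' \<subseteq> S \<Longrightarrow> strongly_psh_on S' u"
  unfolding strongly_psh_on_def using smooth_on_subset by blast

context complex_space
begin

lemma linear_iso_exists:
  assumes "dim UNIV = CARD('d::finite) + 1"
  shows "\<exists>T :: 'v \<Rightarrow> complex ^ ('d option). linear_iso V T"
proof -
  obtain B where "B \<subseteq> UNIV" and B: "independent B" "UNIV \<subseteq> span B" "card B = dim UNIV"
    by (rule basis_exists[of UNIV])
  then have fin: "finite B" using assms by (intro card_ge_0_finite) simp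
  have span: "v \<in> span B" for v using B(2) by blast
  have "card B = CARD('d option)" using B(3) assms by simp
  then obtain b :: "'d option \<Rightarrow> 'v" where b: "bij_betw b UNIV B"
    using finite_same_card_bij[of "UNIV :: 'd option set" B] fin by auto
  then have bB: "b i \<in> B" for i by (auto simp: bij_betw_def)
  define T where "T v = (\<chi> i. representation B v (b i))" for v
  have add: "T (u + v) = T u + T v" for u v
    by (simp add: T_def vec_eq_iff representation_add[OF B(1) span span])
  have scale: "T (smul c v) = c *s T v" for c v
    by (simp add: T_def vec_eq_iff representation_scale[OF B(1) span])
  have rep: "(\<Sum>i\<in>UNIV. smul (T v $ i) (b i)) = v" for v
    using sum_representation_eq[OF B(1) span fin order_refl, of v]
      sum.reindex_bij_betw[OF b, of "\<lambda>x. smul (representation B v x) x"] by (simp add: T_def)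
  have Tb: "T (b i) = axis i 1" for i
    using b by (auto simp: T_def vec_eq_iff axis_def representation_basis[OF B(1) bB] bij_betw_def inj_eq)
  have Tsum: "T (\<Sum>i\<in>I. f i) = (\<Sum>i\<in>I. T (f i))" for f and I :: "'d option set"
    using scale[of 0 0] by (induction I rule: infinite_finite_induct) (simp_all add: add)
  have "T (\<Sum>i\<in>UNIV. smul (x $ i) (b i)) = x" for x
    unfolding Tsum scale Tb by (simp add: vec_eq_iff axis_def if_distrib cong: if_cong)
  then have "bij T" using rep by (intro o_bij[of "\<lambda>x. \<Sum>i\<in>UNIV. smul (x $ i) (b i)"]) (auto simp: fun_eq_iff)
  then show ?thesis using add scale by (intro exI[of _ T]) (simp add: linear_iso_def)
qed

text \<open>Normalizing a functional at its largest coefficient puts it into the ball of radius CARD('d)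
  of one of the finitely many permuted charts; this replaces compactness of projective space.\<close>

lemma hyperplane_bounded_chart:
  fixes T :: "'v \<Rightarrow> complex ^ ('d::finite option)"
  assumes T: "linear_iso V T" and P: "P \<in> hyperplanes V"
  defines "p \<equiv> \<lambda>i a. if a = None then i else if a = i then None else a"
  shows "\<exists>i a. norm a \<le> real CARD('d) \<and> P = level (chart_functional (\<lambda>v. \<chi> b. T v $ p i b) a) 0"
proof -
  \<comment> \<open>\<open>p i\<close> exchanges \<open>None\<close> and \<open>i\<close> and fixes
    all else, so it is its own inverse.\<close>
  have bp: "bij (p i)" for i
    by (rule o_bij[of "p i"]) (auto simp: p_def fun_eq_iff)
  obtain l e where l: "normalized_functional l e" "P = level l 0" using hyperplane_cases[OF P] .
  define c where "c i = l (std_frame V T i)" for i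
  have "Max (range (\<lambda>i. cmod (c i))) \<in> range (\<lambda>i. cmod (c i))" by (intro Max_in) auto
  then obtain i where i: "Max (range (\<lambda>i. cmod (c i))) = cmod (c i)" by (rule rangeE)
  have max: "cmod (c j) \<le> cmod (c i)" for j unfolding i[symmetric] by (rule Max_ge) auto
  have ci: "c i \<noteq> 0"
  proof
    assume "c i = 0"
    then have "c j = 0" for j using max[of j] by simp
    then have "l e = 0" using functional_expansion[OF T l(1), of e] by (simp add: c_def)
    then show False using normalized_functionalD(3)[OF l(1)] by simp
  qed
  define T' where "T' = (\<lambda>v. \<chi> b. T v $ p i b)"
  have T': "linear_iso V T'" unfolding T'_def by (rule linear_iso_permute(1)[OF T bp])
  have fr: "std_frame V T' b = std_frame V T (p i b)" for b
    unfolding T'_def by (rule linear_iso_permute(2)[OF T bp])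
  define l' where "l' v = l v / c i" for v
  have l': "normalized_functional l' (std_frame V T' None)"
    unfolding normalized_functional_def l'_def fr
    using ci by (simp add: normalized_functionalD[OF l(1)] add_divide_distrib p_def c_def)
  define a where "a = (\<chi> j. l' (std_frame V T' (Some j)))"
  have "cmod (a $ j) \<le> 1" for j
    using max ci by (simp add: a_def l'_def fr norm_divide field_simps flip: c_def)
  \<comment> \<open>The radius CARD('d) comes from bounding the Euclidean norm by the sum of the
    moduli, each at most 1.\<close>
  then have "(\<Sum>j\<in>UNIV. cmod (a $ j)) \<le> (\<Sum>j\<in>(UNIV :: 'd set). 1)" by (intro sum_mono)
  moreover have "norm a \<le> (\<Sum>j\<in>UNIV. cmod (a $ j))" unfolding norm_vec_def by (rule L2_set_le_sum) simp
  ultimately have "norm a \<le> real CARD('d)" by simp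
  moreover have "P = level (chart_functional T' a) 0"
    unfolding a_def functional_eq_chart_functional[OF T' l', symmetric] l(2) using ci by (auto simp: l'_def)
  ultimately show ?thesis unfolding T'_def by blast
qed

text \<open>Changing the functional with a given kernel multiplies both metrics by the same |z|^2,
  so the difference of logarithms depends on the hyperplane alone. It is continuous and positive on
  finitely many compact balls that reach every hyperplane, so its extrema on them give the two
  bounds.\<close>

lemma metric_ratio_bounds:
  fixes T :: "'v \<Rightarrow> complex ^ ('d::finite option)" and \<kappa> \<kappa>' :: "'v set \<times> 'v set \<Rightarrow> real"
  assumes T: "linear_iso V T"
    and pos: "positively_curved (O1_space V :: ('v set, 'v set, 'd, 1) vbundle) \<kappa>"
      "positively_curved (O1_space V :: ('v set, 'v set, 'd, 1) vbundle) \<kappa>'"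
    and gt: "\<And>l e. normalized_functional l e \<Longrightarrow> \<kappa>' (level l 0, level l 1) < \<kappa> (level l 0, level l 1)"
  shows "\<exists>\<delta>>0. \<exists>M. \<forall>l e. normalized_functional l e \<longrightarrow>
    \<delta> \<le> ln (\<kappa> (level l 0, level l 1)) - ln (\<kappa>' (level l 0, level l 1)) \<and>
    ln (\<kappa> (level l 0, level l 1)) - ln (\<kappa>' (level l 0, level l 1)) \<le> M"
proof -
  define p where "p = (\<lambda>(i :: 'd option) a. if a = None then i else if a = i then None else a)"
  have bp: "bij (p i)" for i
    by (rule o_bij[of "p i"]) (auto simp: p_def fun_eq_iff)
  define Ti where "Ti i = (\<lambda>v. \<chi> b. T v $ p i b)" for i
  have Ti: "linear_iso V (Ti i)" for i unfolding Ti_def by (rule linear_iso_permute(1)[OF T bp])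
  have hm: "hermitian_metric (quotient_space V P) (\<lambda>v. \<kappa> (P, v))"
      "hermitian_metric (quotient_space V P) (\<lambda>v. \<kappa>' (P, v))" if "P \<in> hyperplanes V" for P
    using pos that by (simp_all add: positively_curved_def bundle_metric_def O1_space_def)
  define d where "d l = ln (\<kappa> (level l 0, level l 1)) - ln (\<kappa>' (level l 0, level l 1))" for l
  have d_indep: "d l = d l'" if l: "normalized_functional l e" "normalized_functional l' e'" "level l 0 = level l' 0"
    for l e l' e'
  proof -
    note h = hm[OF level_hyperplane[OF l(2)]] hm[OF level_hyperplane[OF l(1)]]
    have "level l 1 \<in> vcarrier (quotient_space V (level l 0))" unfolding quotient_carrier[OF l(1)] by simp
    then have "level l 1 \<in> range (level l')" unfolding l(3) quotient_carrier[OF l(2)] .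
    then obtain z where z: "level l 1 = level l' z" by auto
    have z0: "z \<noteq> 0" using level_eq_iff[OF l(1), of 1 0] z l(3) by auto
    show ?thesis unfolding d_def l(3) z
      using z0 hermitian_metric_level(1)[OF l(2) h(1), of z] hermitian_metric_level(1)[OF l(2) h(2), of z]
        hermitian_metric_level(2)[OF l(2) h(1)] hermitian_metric_level(2)[OF l(2) h(2)]
      by (simp add: ln_mult)
  qed
  have dpos: "0 < d l" if "normalized_functional l e" for l e
  proof -
    note h = hm[OF level_hyperplane[OF that]]
    show ?thesis unfolding d_def
      using gt[OF that] hermitian_metric_level(2)[OF that h(1)] hermitian_metric_level(2)[OF that h(2)] by simp
  qed
  have "\<exists>\<delta> M. 0 < \<delta> \<and> (\<forall>a. norm a \<le> real CARD('d) \<longrightarrow>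
      \<delta> \<le> d (chart_functional (Ti i) a) \<and> d (chart_functional (Ti i) a) \<le> M)" for i
  proof -
    let ?f = "\<lambda>a. d (chart_functional (Ti i) a)"
    have "Ck_on 0 UNIV (\<lambda>a. - ln (\<kappa> (chart_point (Ti i) a)))" "Ck_on 0 UNIV (\<lambda>a. - ln (\<kappa>' (chart_point (Ti i) a)))"
      using strongly_psh_on_O1_space[OF Ti pos(1)] strongly_psh_on_O1_space[OF Ti pos(2)]
      unfolding strongly_psh_on_def smooth_on_def by blast+
    then have "continuous_on UNIV (\<lambda>a. - ln (\<kappa>' (chart_point (Ti i) a)) - - ln (\<kappa> (chart_point (Ti i) a)))"
      unfolding Ck_on.simps by (intro continuous_on_diff)
    then have "continuous_on UNIV ?f" by (simp add: d_def chart_point_def)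
    then have c: "continuous_on (cball 0 (real CARD('d))) ?f" by (rule continuous_on_subset) simp
    have ne: "cball (0 :: complex ^ 'd) (real CARD('d)) \<noteq> {}" by simp
    obtain a0 where a0: "\<forall>a\<in>cball 0 (real CARD('d)). ?f a0 \<le> ?f a"
      using continuous_attains_inf[OF compact_cball ne c] by blast
    obtain a1 where a1: "\<forall>a\<in>cball 0 (real CARD('d)). ?f a \<le> ?f a1"
      using continuous_attains_sup[OF compact_cball ne c] by blast
    show ?thesis
      by (rule exI[of _ "?f a0"], rule exI[of _ "?f a1"])
        (use a0 a1 dpos[OF chart_functional[OF Ti]] in auto)
  qed
  then obtain \<delta> M where dM: "\<And>i. 0 < \<delta> i" "\<And>i a. norm a \<le> real CARD('d) \<Longrightarrow>
      \<delta> i \<le> d (chart_functional (Ti i) a) \<and> d (chart_functional (Ti i) a) \<le> M i" by metis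
  have "Min (range \<delta>) \<le> d l \<and> d l \<le> Max (range M)" if l: "normalized_functional l e" for l e
  proof -
    obtain i a where ia: "norm a \<le> real CARD('d)" "level l 0 = level (chart_functional (Ti i) a) 0"
      using hyperplane_bounded_chart[OF T level_hyperplane[OF l]] unfolding Ti_def p_def by blast
    have "d l = d (chart_functional (Ti i) a)" by (rule d_indep[OF l chart_functional[OF Ti] ia(2)])
    moreover have "Min (range \<delta>) \<le> \<delta> i" "M i \<le> Max (range M)" by auto
    ultimately show ?thesis using dM(2)[OF ia(1), of i] by linarith
  qed
  moreover have "0 < Min (range \<delta>)" using dM(1) by (subst Min_gr_iff) auto
  ultimately show ?thesis unfolding d_def by blast
qed

end

text \<open>The conditions express that near r_j the j-th weight beats the other two. \<delta> and M
  bound the consecutive differences \<phi>_2 - \<phi>_1 and \<phi>_3 - \<phi>_2, hence 2 \<delta>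
  and 2 M bound \<phi>_3 - \<phi>_1. The margin is 2 \<epsilon> at r_3 because there the regularized
  maximum of the first two weights is only estimated, with an error of \<epsilon>.\<close>

lemma radii_exist:
  fixes \<delta> M :: real
  assumes "0 < \<delta>" "\<delta> \<le> M"
  shows "\<exists>\<epsilon> m1 m2 m3 r1 r2 r3 :: real. 0 < \<epsilon> \<and> 0 < m1 \<and> 0 < m2 \<and> 0 < m3 \<and> 0 < r1 \<and> r1 < r2 \<and> r2 < r3 \<and> r3 < 1 \<and>
    (\<forall>\<^sub>F t in nhds r1. M + \<epsilon> + m2 * (t\<^sup>2 - r2\<^sup>2) \<le> m1 * (t\<^sup>2 - r1\<^sup>2) \<and> 2 * M + \<epsilon> + m3 * (t\<^sup>2 - r3\<^sup>2) \<le> m1 * (t\<^sup>2 - r1\<^sup>2)) \<and>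
    (\<forall>\<^sub>F t in nhds r2. \<epsilon> - \<delta> + m1 * (t\<^sup>2 - r1\<^sup>2) \<le> m2 * (t\<^sup>2 - r2\<^sup>2) \<and> M + \<epsilon> + m3 * (t\<^sup>2 - r3\<^sup>2) \<le> m2 * (t\<^sup>2 - r2\<^sup>2)) \<and>
    (\<forall>\<^sub>F t in nhds r3. 2 * \<epsilon> - 2 * \<delta> + m1 * (t\<^sup>2 - r1\<^sup>2) \<le> m3 * (t\<^sup>2 - r3\<^sup>2) \<and> 2 * \<epsilon> - \<delta> + m2 * (t\<^sup>2 - r2\<^sup>2) \<le> m3 * (t\<^sup>2 - r3\<^sup>2))"
proof -
  \<comment> \<open>Every condition is strict at the radius and continuous in t, so it persists
    nearby.\<close>
  have ev: "\<forall>\<^sub>F t in nhds r. c + m * (t\<^sup>2 - x) \<le> m' * (t\<^sup>2 - x')" if "c + m * (r\<^sup>2 - x) < m' * (r\<^sup>2 - x')"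
    for r c m x m' x' :: real
  proof -
    have "((\<lambda>t. m' * (t\<^sup>2 - x') - (c + m * (t\<^sup>2 - x))) \<longlongrightarrow> m' * (r\<^sup>2 - x') - (c + m * (r\<^sup>2 - x))) (nhds r)"
      by (intro tendsto_intros filterlim_ident)
    from order_tendstoD(1)[OF this, of 0] that show ?thesis by (auto elim: eventually_mono)
  qed
  \<comment> \<open>The squared radii are 1/4, 1/2 and 1/2 + h. The slope \<open>m2\<close> gains M
    + \<delta> over the first gap; \<open>h\<close> is so short that \<open>m2\<close> gains only
    \<delta>/2 over the second; \<open>m3\<close> is so steep that it gains 2 M + \<delta> over
    \<open>h\<close>. The slope \<delta>/2 chosen for \<open>m1\<close> gains less than \<delta>/4
    in total, and \<epsilon> = \<delta>/8 fits into all margins.\<close>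
  define m2 where "m2 = 4 * (M + \<delta>)"
  define h where "h = \<delta> / (2 * m2)"
  define m3 where "m3 = (2 * M + \<delta>) / h"
  have m2: "0 < m2" and h0: "0 < h" using assms by (auto simp: m2_def h_def)
  have h1: "h < 1/4" using assms by (simp add: h_def m2_def field_simps)
  have m3: "0 < m3" using assms h0 by (auto simp: m3_def)
  have m2h: "m2 * h = \<delta> / 2" using m2 by (simp add: h_def)
  have m3h: "m3 * h = 2 * M + \<delta>" using h0 by (simp add: m3_def)
  have dh: "\<delta> * h < \<delta> / 4" using mult_strict_left_mono[OF h1 assms(1)] by simp
  define r1 r2 r3 where "r1 = (1/2 :: real)" "r2 = sqrt (1/2)" "r3 = sqrt (1/2 + h)"
  have sq: "r1\<^sup>2 = 1/4" "r2\<^sup>2 = 1/2" "r3\<^sup>2 = 1/2 + h" using h0 by (simp_all add: r1_r2_r3_def power2_eq_square)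
  have r: "0 < r1" "r1 < r2" "r2 < r3" "r3 < 1"
  proof -
    show "0 < r1" by (simp add: r1_r2_r3_def)
    show "r1 < r2" unfolding r1_r2_r3_def by (rule real_less_rsqrt) (simp add: power2_eq_square)
    show "r2 < r3" using h0 by (simp add: r1_r2_r3_def)
    show "r3 < 1" using h1 by (simp add: r1_r2_r3_def)
  qed
  show ?thesis
  proof (rule exI[of _ "\<delta>/8"], rule exI[of _ "\<delta>/2"], rule exI[of _ m2], rule exI[of _ m3],
      rule exI[of _ r1], rule exI[of _ r2], rule exI[of _ r3], intro conjI eventually_conj ev)
    show "M + \<delta>/8 + m2 * (r1\<^sup>2 - r2\<^sup>2) < \<delta>/2 * (r1\<^sup>2 - r1\<^sup>2)"
      unfolding sq using assms by (simp add: m2_def)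
    show "2 * M + \<delta>/8 + m3 * (r1\<^sup>2 - r3\<^sup>2) < \<delta>/2 * (r1\<^sup>2 - r1\<^sup>2)"
      unfolding sq using assms m3 m3h by (simp add: algebra_simps)
    show "\<delta>/8 - \<delta> + \<delta>/2 * (r2\<^sup>2 - r1\<^sup>2) < m2 * (r2\<^sup>2 - r2\<^sup>2)"
      unfolding sq using assms by simp
    show "M + \<delta>/8 + m3 * (r2\<^sup>2 - r3\<^sup>2) < m2 * (r2\<^sup>2 - r2\<^sup>2)"
      unfolding sq using assms m3h by (simp add: algebra_simps)
    show "2 * (\<delta>/8) - 2 * \<delta> + \<delta>/2 * (r3\<^sup>2 - r1\<^sup>2) < m3 * (r3\<^sup>2 - r3\<^sup>2)"
      unfolding sq using assms dh by (simp add: algebra_simps)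
    show "2 * (\<delta>/8) - \<delta> + m2 * (r3\<^sup>2 - r2\<^sup>2) < m3 * (r3\<^sup>2 - r3\<^sup>2)"
      unfolding sq using assms m2h by (simp add: algebra_simps)
  qed (use assms m2 m3 r in auto)
qed

section \<open>The regularized maximum of two numbers\<close>

definition reg_max :: "(real \<Rightarrow> real) \<Rightarrow> real \<Rightarrow> real \<Rightarrow> real" where
  "reg_max \<gamma> u v = u + \<gamma> (v - u)"

text \<open>The correction depends on the difference of the arguments only. This is what allows the
  glued metric to be defined without charts.\<close>

lemma reg_max_shift: "reg_max \<gamma> (c + u) (c + v) = c + reg_max \<gamma> u v"
  by (simp add: reg_max_def)

context
  fixes \<gamma> :: "real \<Rightarrow> real" and \<epsilon> :: real
  assumes lo: "\<forall>x\<le>-\<epsilon>. \<gamma> x = 0" and hi: "\<forall>x\<ge>\<epsilon>. \<gamma> x = x" and mono: "mono \<gamma>"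
begin

lemma reg_max_left: "v + \<epsilon> \<le> u \<Longrightarrow> reg_max \<gamma> u v = u"
  using lo by (simp add: reg_max_def)

lemma reg_max_right: "u + \<epsilon> \<le> v \<Longrightarrow> reg_max \<gamma> u v = v"
  using hi by (simp add: reg_max_def)

text \<open>Once v - u reaches \<epsilon> the value is v itself; before that, monotonicity bounds
  the correction by \<gamma>(\<epsilon>) = \<epsilon>.\<close>

lemma reg_max_le: "u \<le> w \<Longrightarrow> v \<le> w \<Longrightarrow> 0 \<le> \<epsilon> \<Longrightarrow> reg_max \<gamma> u v \<le> w + \<epsilon>"
proof (cases "u + \<epsilon> \<le> v")
  case False
  then have "\<gamma> (v - u) \<le> \<gamma> \<epsilon>" by (intro monoD[OF mono]) simp
  then show "u \<le> w \<Longrightarrow> v \<le> w \<Longrightarrow> 0 \<le> \<epsilon> \<Longrightarrow> reg_max \<gamma> u v \<le> w + \<epsilon>" using hi by (simp add: reg_max_def)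
qed (simp add: reg_max_right)

end

section \<open>The metric\<close>

theorem lemma4p2:
  fixes smul :: "complex \<Rightarrow> 'v::ab_group_add \<Rightarrow> 'v"
    and V :: "'v cvs"
    and OPV :: "('v set, 'v set, 'd::finite, 1) vbundle"
    and F :: "(complex ^ 'm::finite, 'v, 'm, 'd option) vbundle"
    and \<kappa> :: "nat \<Rightarrow> 'v set \<times> 'v set \<Rightarrow> real"
  assumes vs: "vector_space smul"
    and dim: "vector_space.dim smul (UNIV :: 'v set) = CARD('d) + 1"
    and V: "V = cvs_of smul"
    and OPV: "OPV = O1_space V"
    and F: "F = trivial_bundle (ball 0 1) V"
    and pos: "\<forall>j\<in>{1, 2, 3}. positively_curved OPV (\<kappa> j)"
    and gt: "\<forall>P\<in>base OPV. \<forall>v\<in>vcarrier (fiber OPV P). v \<noteq> vzero (fiber OPV P) \<longrightarrow>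
               \<kappa> 1 (P, v) > \<kappa> 2 (P, v) \<and> \<kappa> 2 (P, v) > \<kappa> 3 (P, v)"
  shows "\<exists>(\<rho> :: nat \<Rightarrow> real) (k :: ((complex ^ 'm) \<times> 'v set) \<times> 'v set \<Rightarrow> real).
           0 < \<rho> 1 \<and> \<rho> 1 < \<rho> 2 \<and> \<rho> 2 < \<rho> 3 \<and> \<rho> 3 < 1 \<and>
           positively_curved (O1_bundle F) k \<and>
           (\<forall>j\<in>{1, 2, 3}.
              (\<forall>s\<in>ball 0 1. norm s = \<rho> j \<longrightarrow>
                 (\<forall>P\<in>base OPV. \<forall>v\<in>vcarrier (fiber OPV P). k ((s, P), v) = \<kappa> j (P, v))) \<and>
              (\<exists>\<epsilon>>0. \<forall>s\<in>ball 0 1. \<bar>norm s - \<rho> j\<bar> < \<epsilon> \<longrightarrow>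
                 (\<exists>c>0. \<forall>P\<in>base OPV. \<forall>v\<in>vcarrier (fiber OPV P).
                    k ((s, P), v) = c * \<kappa> j (P, v))))"
proof -
  interpret complex_space smul unfolding complex_space_def by (rule vs)
  let ?O = "O1_space (cvs_of smul) :: ('v set, 'v set, 'd, 1) vbundle"
  have base: "base OPV = hyperplanes (cvs_of smul)" and fiber: "fiber OPV = quotient_space (cvs_of smul)"
    by (simp_all add: OPV V O1_space_def)
  have pos': "positively_curved ?O (\<kappa> j)" if "j \<in> {1, 2, 3}" for j
    using pos that unfolding OPV V by blast
  have hm: "hermitian_metric (quotient_space (cvs_of smul) P) (\<lambda>v. \<kappa> j (P, v))"
    if "P \<in> hyperplanes (cvs_of smul)" "j \<in> {1, 2, 3}" for P j
    using pos'[OF that(2)] that(1) by (simp add: positively_curved_def bundle_metric_def O1_space_def)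
  define N where "N j l = \<kappa> j (level l 0, level l 1)" for j and l :: "'v \<Rightarrow> complex"
  have \<kappa>: "\<kappa> j (level l 0, level l z) = (cmod z)\<^sup>2 * N j l" "0 < N j l"
    if "normalized_functional l e" "j \<in> {1, 2, 3}" for j l e z
    unfolding N_def
    by (fact hermitian_metric_level[OF that(1) hm[OF level_hyperplane[OF that(1)] that(2)]])+
  have gt': "N 2 l < N 1 l" "N 3 l < N 2 l" if l: "normalized_functional l e" for l e
  proof -
    have "level l 0 \<in> base OPV" unfolding base by (rule level_hyperplane[OF l])
    moreover have "level l 1 \<in> vcarrier (fiber OPV (level l 0))"
      unfolding fiber quotient_carrier[OF l] by simp
    moreover have "level l 1 \<noteq> vzero (fiber OPV (level l 0))"
      unfolding fiber quotient_zero[OF l] using level_eq_iff[OF l] by simp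
    ultimately show "N 2 l < N 1 l" "N 3 l < N 2 l" using gt unfolding N_def by blast+
  qed
  obtain T :: "'v \<Rightarrow> complex ^ ('d option)" where T: "linear_iso (cvs_of smul) T"
    using linear_iso_exists[OF dim] by blast
  obtain \<delta>1 M1 where b1: "0 < \<delta>1" "\<forall>l e. normalized_functional l e \<longrightarrow>
      \<delta>1 \<le> ln (N 1 l) - ln (N 2 l) \<and> ln (N 1 l) - ln (N 2 l) \<le> M1"
    using metric_ratio_bounds[OF T pos' pos', of 1 2] gt' unfolding N_def by blast
  obtain \<delta>2 M2 where b2: "0 < \<delta>2" "\<forall>l e. normalized_functional l e \<longrightarrow>
      \<delta>2 \<le> ln (N 2 l) - ln (N 3 l) \<and> ln (N 2 l) - ln (N 3 l) \<le> M2"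
    using metric_ratio_bounds[OF T pos' pos', of 2 3] gt' unfolding N_def by blast
  define \<delta> where "\<delta> = min \<delta>1 \<delta>2"
  \<comment> \<open>Taking \<delta> into the maximum gives \<delta> <= M at once, as
    \<open>radii_exist\<close> asks.\<close>
  define M where "M = max \<delta> (max M1 M2)"
  have \<delta>M: "0 < \<delta>" "\<delta> \<le> M" using b1 b2 by (auto simp: \<delta>_def M_def)
  have bd: "\<delta> \<le> ln (N 1 l) - ln (N 2 l)" "ln (N 1 l) - ln (N 2 l) \<le> M"
      "\<delta> \<le> ln (N 2 l) - ln (N 3 l)" "ln (N 2 l) - ln (N 3 l) \<le> M" if "normalized_functional l e" for l e
    using b1(2)[rule_format, OF that] b2(2)[rule_format, OF that] by (auto simp: \<delta>_def M_def)
  obtain \<epsilon> m1 m2 m3 r1 r2 r3 where m: "0 < \<epsilon>" "0 < m1" "0 < m2" "0 < m3"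
    and r: "0 < r1" "r1 < r2" "r2 < r3" "r3 < 1"
    and near1: "\<forall>\<^sub>F t in nhds r1. M + \<epsilon> + m2 * (t\<^sup>2 - r2\<^sup>2) \<le> m1 * (t\<^sup>2 - r1\<^sup>2) \<and>
        2 * M + \<epsilon> + m3 * (t\<^sup>2 - r3\<^sup>2) \<le> m1 * (t\<^sup>2 - r1\<^sup>2)"
    and near2: "\<forall>\<^sub>F t in nhds r2. \<epsilon> - \<delta> + m1 * (t\<^sup>2 - r1\<^sup>2) \<le> m2 * (t\<^sup>2 - r2\<^sup>2) \<and>
        M + \<epsilon> + m3 * (t\<^sup>2 - r3\<^sup>2) \<le> m2 * (t\<^sup>2 - r2\<^sup>2)"
    and near3: "\<forall>\<^sub>F t in nhds r3. 2 * \<epsilon> - 2 * \<delta> + m1 * (t\<^sup>2 - r1\<^sup>2) \<le> m3 * (t\<^sup>2 - r3\<^sup>2) \<and>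
        2 * \<epsilon> - \<delta> + m2 * (t\<^sup>2 - r2\<^sup>2) \<le> m3 * (t\<^sup>2 - r3\<^sup>2)"
    using radii_exist[OF \<delta>M] by (elim exE conjE) (rule that)
  obtain \<gamma> \<gamma>' \<gamma>2 :: "real \<Rightarrow> real" where \<gamma>: "smooth_on UNIV \<gamma>" "\<forall>x. (\<gamma> has_real_derivative \<gamma>' x) (at x)"
    "\<forall>x. (\<gamma>' has_real_derivative \<gamma>2 x) (at x)" "\<forall>x. 0 \<le> \<gamma>' x" "\<forall>x. \<gamma>' x \<le> 1" "\<forall>x. 0 \<le> \<gamma>2 x"
    "\<forall>x\<le>-\<epsilon>. \<gamma> x = 0" "\<forall>x\<ge>\<epsilon>. \<gamma> x = x"
    using regularized_positive_part_exists[OF m(1)] by (elim exE conjE) (rule that)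
  have mono: "mono \<gamma>"
    by (rule monoI, rule DERIV_nonneg_imp_nondecreasing) (use \<gamma>(2,4) in blast)+
  note rm = reg_max_left[OF \<gamma>(7,8) mono] reg_max_right[OF \<gamma>(7,8) mono] reg_max_le[OF \<gamma>(7,8) mono]
  have psh_rm: "strongly_psh_on UNIV (\<lambda>z. reg_max \<gamma> (u z) (v z))"
    if "strongly_psh_on UNIV u" "strongly_psh_on UNIV v" for u v :: "complex ^ ('m + 'd) \<Rightarrow> real"
    unfolding reg_max_def
    by (rule strongly_psh_on_regularized_max[OF open_UNIV that \<gamma>(1) \<gamma>(2)[rule_format] \<gamma>(3)[rule_format]])
      (use \<gamma> in auto)
  define \<Phi> where "\<Phi> u1 u2 u3 = reg_max \<gamma> (reg_max \<gamma> u1 u2) u3" for u1 u2 u3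
  have shift: "\<Phi> (c + u1) (c + u2) (c + u3) = c + \<Phi> u1 u2 u3" for c u1 u2 u3
    by (simp add: \<Phi>_def reg_max_shift)
  \<comment> \<open>The radial terms. \<open>q j\<close> vanishes at the radius
    \<open>\<rho> j\<close>, which makes the factor in front of \<kappa>_j equal to 1 on that
    sphere.\<close>
  define q where "q j t = (if j = 1 then m1 * (t\<^sup>2 - r1\<^sup>2) else if j = 2 then m2 * (t\<^sup>2 - r2\<^sup>2)
      else m3 * (t\<^sup>2 - r3\<^sup>2))" for j :: nat and t :: real
  define \<rho> where "\<rho> j = (if j = 1 then r1 else if j = 2 then r2 else r3)" for j :: nat
  \<comment> \<open>An arbitrary functional with kernel P. The metric uses it only through
    \<open>D\<close>, which does not depend on the choice, by \<open>D_indep\<close>.\<close>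
  define L where "L P = (SOME l. \<exists>e. normalized_functional l e \<and> P = level l 0)" for P
  have L: "\<exists>e. normalized_functional (L P) e \<and> P = level (L P) 0" if P: "P \<in> hyperplanes (cvs_of smul)" for P
  proof -
    have "\<exists>l e. normalized_functional l e \<and> P = level l 0"
      using hyperplane_cases[OF P] by metis
    then show ?thesis unfolding L_def by (rule someI_ex)
  qed
  \<comment> \<open>In terms of weights this is \<phi>_j - \<phi>_1. In particular
    \<open>D 1 l\<close> is 0, which is why \<open>q 1\<close> stands alone as the first argument of
    \<Phi> below.\<close>
  define D where "D j l = ln (N 1 l) - ln (N j l)" for j and l
  define k where "k = (\<lambda>((s :: complex ^ 'm, P), A). \<kappa> 1 (P, A) *
      exp (- \<Phi> (q 1 (norm s)) (D 2 (L P) + q 2 (norm s)) (D 3 (L P) + q 3 (norm s))))"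
  have D_indep: "D j (L P) = D j l" if l: "normalized_functional l e" "P = level l 0" and j: "j \<in> {1, 2, 3}" for j l e P
  proof -
    obtain e' where L': "normalized_functional (L P) e'" "P = level (L P) 0"
      using L[of P] level_hyperplane[OF l(1)] l(2) by blast
    have "level (L P) 1 \<in> vcarrier (quotient_space (cvs_of smul) P)"
      using quotient_carrier[OF L'(1)] L'(2) by simp
    then have "level (L P) 1 \<in> range (level l)" unfolding l(2) quotient_carrier[OF l(1)] .
    then obtain z where z: "level (L P) 1 = level l z" by (rule rangeE)
    have z0: "z \<noteq> 0"
    proof
      assume "z = 0"
      then have "level (L P) 1 = level (L P) 0" using z l(2) L'(2) by simp
      then show False using level_eq_iff[OF L'(1)] by simp
    qed
    have "N i (L P) = (cmod z)\<^sup>2 * N i l" if "i \<in> {1, 2, 3}" for i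
    proof -
      have "N i (L P) = \<kappa> i (level l 0, level l z)" unfolding N_def z using L'(2) l(2) by simp
      then show ?thesis using \<kappa>(1)[OF l(1) that] by simp
    qed
    then show ?thesis using j z0 \<kappa>(2)[OF l(1) j] \<kappa>(2)[OF l(1), of 1] by (simp add: D_def ln_mult)
  qed
  have curved: "positively_curved (O1_bundle F) k"
    unfolding F V
  proof (rule positively_curved_O1_bundle)
    show "hermitian_metric (quotient_space (cvs_of smul) P) (\<lambda>v. k ((s, P), v))"
      if "P \<in> hyperplanes (cvs_of smul)" for s P
      unfolding k_def using hermitian_metric_scale[OF hm[OF that, of 1]] by simp
    fix T :: "'v \<Rightarrow> complex ^ ('d option)" assume T: "linear_iso (cvs_of smul) T"
    define \<phi> where "\<phi> j a = - ln (\<kappa> j (chart_point T a))" for j a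
    have \<phi>: "strongly_psh_on UNIV (\<phi> j)" if "j \<in> {1, 2, 3}" for j
      unfolding \<phi>_def by (rule strongly_psh_on_O1_space[OF T pos'[OF that]])
    define u where "u j = (\<lambda>x :: complex ^ ('m + 'd). \<phi> j (fiber_part x) + q j (norm (base_part x)))" for j
    have u: "strongly_psh_on UNIV (u j)" if "j \<in> {1, 2, 3}" for j
      using that m strongly_psh_on_add_norm_square[OF \<phi>[OF that]] by (auto simp: u_def q_def)
    have "strongly_psh_on UNIV (\<lambda>x. \<Phi> (u 1 x) (u 2 x) (u 3 x))"
      unfolding \<Phi>_def by (intro psh_rm u) auto
    also have "(\<lambda>x. \<Phi> (u 1 x) (u 2 x) (u 3 x)) = (\<lambda>x. - ln (k ((base_part x, fst (chart_point T (fiber_part x))),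
        snd (chart_point T (fiber_part x)))))"
    proof
      fix x :: "complex ^ ('m + 'd)"
      let ?l = "chart_functional T (fiber_part x)" and ?t = "norm (base_part x)"
      note l = chart_functional[OF T, of "fiber_part x"]
      \<comment> \<open>Adding the local weight - ln \<open>N 1\<close> of \<kappa>_1 to all three
        arguments turns the global differences back into local weights; \<open>shift\<close> carries
        this through \<Phi>.\<close>
      have \<phi>N: "\<phi> j (fiber_part x) = - ln (N 1 ?l) + D j ?l" for j
        by (simp add: \<phi>_def D_def N_def chart_point_def)
      have "k ((base_part x, fst (chart_point T (fiber_part x))), snd (chart_point T (fiber_part x)))
        = N 1 ?l * exp (- \<Phi> (q 1 ?t) (D 2 ?l + q 2 ?t) (D 3 ?l + q 3 ?t))"
        unfolding k_def chart_point_def using D_indep[OF l refl] by (simp add: N_def)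
      then have "- ln (k ((base_part x, fst (chart_point T (fiber_part x))), snd (chart_point T (fiber_part x))))
        = - ln (N 1 ?l) + \<Phi> (q 1 ?t) (D 2 ?l + q 2 ?t) (D 3 ?l + q 3 ?t)"
        using \<kappa>(2)[OF l, of 1] by (simp add: ln_mult)
      also have "\<dots> = \<Phi> (u 1 x) (u 2 x) (u 3 x)"
        unfolding shift[symmetric] u_def \<phi>N by (simp add: D_def add.assoc)
      finally show "\<Phi> (u 1 x) (u 2 x) (u 3 x) = - ln (k ((base_part x, fst (chart_point T (fiber_part x))),
        snd (chart_point T (fiber_part x))))" by simp
    qed
    finally show "strongly_psh_on {x. base_part x \<in> ball 0 1} (\<lambda>x. - ln (k ((base_part x, fst (chart_point T (fiber_part x))),
        snd (chart_point T (fiber_part x)))))"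
      by (rule strongly_psh_on_subset) simp
  qed simp
  \<comment> \<open>Where the j-th argument is selected, \<kappa>_1 exp(-(\<phi>_j - \<phi>_1)) is
    \<kappa>_j again. The remaining factor depends on \<open>norm s\<close> alone and is the
    constant c_s of the theorem.\<close>
  have val: "k ((s, P), A) = exp (- q j (norm s)) * \<kappa> j (P, A)"
    if j: "j \<in> {1, 2, 3}" and P: "P \<in> base OPV" and A: "A \<in> vcarrier (fiber OPV P)"
      and sel: "\<And>l e. normalized_functional l e \<Longrightarrow>
        \<Phi> (q 1 (norm s)) (D 2 l + q 2 (norm s)) (D 3 l + q 3 (norm s)) = D j l + q j (norm s)" for j s P A
  proof -
    obtain e where l: "normalized_functional (L P) e" "P = level (L P) 0" using L P unfolding base by blast
    obtain z where z: "A = level (L P) z" using A quotient_carrier[OF l(1)] l(2) unfolding fiber by auto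
    have k1: "\<kappa> i (P, A) = (cmod z)\<^sup>2 * N i (L P)" if "i \<in> {1, 2, 3}" for i
      using \<kappa>(1)[OF l(1) that, of z] l(2) z by simp
    have "exp (- (D j (L P) + q j (norm s))) = N j (L P) / N 1 (L P) * exp (- q j (norm s))"
      using \<kappa>(2)[OF l(1) j] \<kappa>(2)[OF l(1), of 1] by (simp add: D_def exp_diff exp_add exp_minus field_simps)
    then show ?thesis
      using k1[OF j] k1[of 1] sel[OF l(1)] \<kappa>(2)[OF l(1), of 1] by (simp add: k_def)
  qed
  have near: "\<forall>\<^sub>F t in nhds (\<rho> j). \<forall>l e. normalized_functional l e \<longrightarrow>
      \<Phi> (q 1 t) (D 2 l + q 2 t) (D 3 l + q 3 t) = D j l + q j t" if "j \<in> {1, 2, 3}" for j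
  proof -
    have "j = 1 \<or> j = 2 \<or> j = 3" using that by simp
    then show ?thesis
    proof (elim disjE)
      assume j: "j = 1"
      have "\<rho> j = r1" by (simp add: \<rho>_def j)
      then show ?thesis unfolding j
      proof (simp only:, intro eventually_mono[OF near1] allI impI)
        fix t l e assume t: "M + \<epsilon> + m2 * (t\<^sup>2 - r2\<^sup>2) \<le> m1 * (t\<^sup>2 - r1\<^sup>2) \<and>
          2 * M + \<epsilon> + m3 * (t\<^sup>2 - r3\<^sup>2) \<le> m1 * (t\<^sup>2 - r1\<^sup>2)" and l: "normalized_functional l e"
        have "D 2 l + q 2 t + \<epsilon> \<le> q 1 t" "D 3 l + q 3 t + \<epsilon> \<le> q 1 t"
          using t bd[OF l] by (auto simp: D_def q_def)
        then show "\<Phi> (q 1 t) (D 2 l + q 2 t) (D 3 l + q 3 t) = D 1 l + q 1 t"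
          by (simp add: \<Phi>_def rm D_def)
      qed
    next
      assume j: "j = 2"
      have "\<rho> j = r2" by (simp add: \<rho>_def j)
      then show ?thesis unfolding j
      proof (simp only:, intro eventually_mono[OF near2] allI impI)
        fix t l e assume t: "\<epsilon> - \<delta> + m1 * (t\<^sup>2 - r1\<^sup>2) \<le> m2 * (t\<^sup>2 - r2\<^sup>2) \<and>
          M + \<epsilon> + m3 * (t\<^sup>2 - r3\<^sup>2) \<le> m2 * (t\<^sup>2 - r2\<^sup>2)" and l: "normalized_functional l e"
        have "q 1 t + \<epsilon> \<le> D 2 l + q 2 t" "D 3 l + q 3 t + \<epsilon> \<le> D 2 l + q 2 t"
          using t bd[OF l] by (auto simp: D_def q_def)
        then show "\<Phi> (q 1 t) (D 2 l + q 2 t) (D 3 l + q 3 t) = D 2 l + q 2 t"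
          by (simp add: \<Phi>_def rm)
      qed
    next
      assume j: "j = 3"
      have "\<rho> j = r3" by (simp add: \<rho>_def j)
      then show ?thesis unfolding j
      proof (simp only:, intro eventually_mono[OF near3] allI impI)
        fix t l e assume t: "2 * \<epsilon> - 2 * \<delta> + m1 * (t\<^sup>2 - r1\<^sup>2) \<le> m3 * (t\<^sup>2 - r3\<^sup>2) \<and>
          2 * \<epsilon> - \<delta> + m2 * (t\<^sup>2 - r2\<^sup>2) \<le> m3 * (t\<^sup>2 - r3\<^sup>2)" and l: "normalized_functional l e"
        \<comment> \<open>The maximum of the first two arguments is bounded rather than evaluated:
          it exceeds their common upper bound by at most \<epsilon>, and the second \<epsilon> is
          the margin for the outer maximum.\<close>
        have "q 1 t \<le> D 3 l + q 3 t - 2 * \<epsilon>" "D 2 l + q 2 t \<le> D 3 l + q 3 t - 2 * \<epsilon>"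
          using t bd[OF l] by (auto simp: D_def q_def)
        from rm(3)[OF this] have "reg_max \<gamma> (q 1 t) (D 2 l + q 2 t) + \<epsilon> \<le> D 3 l + q 3 t" using m(1) by simp
        then show "\<Phi> (q 1 t) (D 2 l + q 2 t) (D 3 l + q 3 t) = D 3 l + q 3 t"
          by (simp add: \<Phi>_def rm)
      qed
    qed
  qed
  show ?thesis
  proof (rule exI[of _ \<rho>], rule exI[of _ k], intro conjI ballI)
    show "0 < \<rho> 1" "\<rho> 1 < \<rho> 2" "\<rho> 2 < \<rho> 3" "\<rho> 3 < 1" using r by (simp_all add: \<rho>_def)
    show "positively_curved (O1_bundle F) k" by (rule curved)
    fix j :: nat assume j: "j \<in> {1, 2, 3}"
    show "norm s = \<rho> j \<longrightarrow> (\<forall>P\<in>base OPV. \<forall>v\<in>vcarrier (fiber OPV P). k ((s, P), v) = \<kappa> j (P, v))"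
      for s :: "complex ^ 'm"
    proof (intro impI ballI)
      fix P A assume s: "norm s = \<rho> j" and P: "P \<in> base OPV" and A: "A \<in> vcarrier (fiber OPV P)"
      have "q j (\<rho> j) = 0" by (simp add: q_def \<rho>_def)
      \<comment> \<open>A property that holds eventually in \<open>nhds (\<rho> j)\<close> holds at
        \<open>\<rho> j\<close> itself, so the j-th weight is selected on the sphere and not only
        around it.\<close>
      moreover have "k ((s, P), A) = exp (- q j (norm s)) * \<kappa> j (P, A)"
        by (rule val[OF j P A], unfold s, rule eventually_nhds_x_imp_x[OF near[OF j], rule_format])
      ultimately show "k ((s, P), A) = \<kappa> j (P, A)" using s by simp
    qed
    obtain d where d: "0 < d" "\<And>t l e. dist t (\<rho> j) < d \<Longrightarrow> normalized_functional l e \<Longrightarrow>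
        \<Phi> (q 1 t) (D 2 l + q 2 t) (D 3 l + q 3 t) = D j l + q j t"
      using near[OF j] unfolding eventually_nhds_metric by blast
    show "\<exists>\<epsilon>>0. \<forall>s\<in>ball (0 :: complex ^ 'm) 1. \<bar>norm s - \<rho> j\<bar> < \<epsilon> \<longrightarrow>
       (\<exists>c>0. \<forall>P\<in>base OPV. \<forall>v\<in>vcarrier (fiber OPV P). k ((s, P), v) = c * \<kappa> j (P, v))"
    proof (rule exI[of _ d], intro conjI ballI impI d(1))
      fix s :: "complex ^ 'm" assume s: "\<bar>norm s - \<rho> j\<bar> < d"
      show "\<exists>c>0. \<forall>P\<in>base OPV. \<forall>v\<in>vcarrier (fiber OPV P). k ((s, P), v) = c * \<kappa> j (P, v)"
        by (rule exI[of _ "exp (- q j (norm s))"], intro conjI ballI val[OF j] d(2))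
          (use s in \<open>auto simp: dist_real_def\<close>)
    qed
  qed
qed

end
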